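(* Let $1 \le m \le n$ be integers and let $a_1,\dots,a_m,a'_1,\dots,a'_m$ be positive real numbers. Suppose that $$E(a_1, \dots ,a_m) \hookrightarrow E(a'_1, \dots ,a'_m).$$ Then also $$E(a_1, \dots ,a_m, a_{m+1}, \dots ,a_n) \hookrightarrow E(a'_1, \dots ,a'_m, a_{m+1}, \dots ,a_n)$$ for any positive real values $a_{m+1}, \dots ,a_n$.
   Context: For positive reals $a_1,\dots,a_n$, $E(a_1,\dots,a_n) = \{ \sum_{i=1}^n \pi(x_i^2+y_i^2)/a_i \le 1\} \subset \mathbb{R}^{2n}$, with the symplectic structure restricted from $\omega_0=\sum_{i=1}^n dx_i\wedge dy_i$. For $\lambda>0$, $\lambda E(a_1,\dots,a_n)$ denotes $E(\lambda a_1,\dots,\lambda a_n)$. The notation $E(a_1,\dots,a_n)\hookrightarrow E(b_1,\dots,b_n)$ means: for every $\lambda>1$ there exists a symplectic embedding (an embedding preserving $\omega_0$) of $E(a_1,\dots,a_n)$ into $\lambda E(b_1,\dots,b_n)$. *)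

theory Defs
  imports "HOL-Analysis.Analysis"
begin

primrec Ck_on :: "nat \<Rightarrow> 'a set \<Rightarrow> ('a::real_normed_vector \<Rightarrow> 'b::real_normed_vector) \<Rightarrow> bool"
where
  "Ck_on 0 U f \<longleftrightarrow> continuous_on U f"
| "Ck_on (Suc k) U f \<longleftrightarrow>
     (\<forall>x\<in>U. f differentiable (at x)) \<and>
     (\<forall>v. Ck_on k U (\<lambda>x. frechet_derivative f (at x) v))"

definition smooth_on :: "'a set \<Rightarrow> ('a::real_normed_vector \<Rightarrow> 'b::real_normed_vector) \<Rightarrow> bool"
where "smooth_on U f \<longleftrightarrow> (\<forall>k. Ck_on k U f)"

text \<open>
  Smoothness on a set that is not open means that \<open>f\<close> is smooth on some open neighbourhood.
  As functions are total, \<open>f\<close> is then at the same time the smooth extension; its values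
  off \<open>S\<close> carry no further requirement (neither injectivity nor, below, preservation of the form).
\<close>

definition smooth_embedding_on ::
  "'a set \<Rightarrow> ('a::real_normed_vector \<Rightarrow> 'b::real_normed_vector) \<Rightarrow> bool"
where
  "smooth_embedding_on S f \<longleftrightarrow>
     (\<exists>U. open U \<and> S \<subseteq> U \<and> smooth_on U f) \<and>
     (\<forall>p\<in>S. inj (frechet_derivative f (at p))) \<and>
     (\<exists>g. homeomorphism S (f ` S) f g)"

text \<open>
  \<open>\<real>\<^sup>2\<^sup>n\<close> is the type \<open>(real ^ 'n) \<times> (real ^ 'n)\<close>, a point being the pair
  \<open>(x, y)\<close> of its vectors of \<open>x\<close>- and \<open>y\<close>-coordinates.
\<close>

definition \<omega>\<^sub>0 :: "(real ^ 'n) \<times> (real ^ 'n) \<Rightarrow> (real ^ 'n) \<times> (real ^ 'n) \<Rightarrow> real"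
where "\<omega>\<^sub>0 u v = (\<Sum>i\<in>UNIV. fst u $ i * snd v $ i - snd u $ i * fst v $ i)"

definition symplectic_embedding_on ::
  "((real ^ 'n) \<times> (real ^ 'n)) set \<Rightarrow> ((real ^ 'n) \<times> (real ^ 'n) \<Rightarrow> (real ^ 'n) \<times> (real ^ 'n)) \<Rightarrow> bool"
where
  "symplectic_embedding_on S f \<longleftrightarrow>
     smooth_embedding_on S f \<and>
     (\<forall>p\<in>S. \<forall>u v.
        \<omega>\<^sub>0 (frechet_derivative f (at p) u) (frechet_derivative f (at p) v) = \<omega>\<^sub>0 u v)"

definition ellipsoid :: "('n::finite \<Rightarrow> real) \<Rightarrow> ((real ^ 'n) \<times> (real ^ 'n)) set"
where "ellipsoid a = {(x, y). (\<Sum>i\<in>UNIV. pi * ((x $ i)\<^sup>2 + (y $ i)\<^sup>2) / a i) \<le> 1}"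

text \<open>The scaled ellipsoid \<open>c E(b)\<close> is \<open>E(c b)\<close>: the areas are scaled, not the points.\<close>

definition ellipsoid_embeds :: "('n::finite \<Rightarrow> real) \<Rightarrow> ('n \<Rightarrow> real) \<Rightarrow> bool"
  (infix "\<hookrightarrow>\<^sub>E" 50)
where
  "a \<hookrightarrow>\<^sub>E b \<longleftrightarrow>
     (\<forall>c>1. \<exists>f. symplectic_embedding_on (ellipsoid a) f \<and>
                f ` ellipsoid a \<subseteq> ellipsoid (\<lambda>i. c * b i))"

end

theory Submission imports Defs begin

text \<open>
  A symplectic embedding \<open>\<phi>\<close> of \<open>E(a\<^sub>1, \<dots>, a\<^sub>m)\<close> is applied fibrewise. Over a point \<open>w\<close> of the remaining
  coordinates, with \<open>K(w) = \<Sum> \<pi> |w\<^sub>j|\<^sup>2 / a\<^sub>j\<close>, the fibre of \<open>E(a\<^sub>1, \<dots>, a\<^sub>n)\<close> is \<open>E(a\<^sub>1, \<dots>, a\<^sub>m)\<close> scaled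
  by \<open>1 - K(w)\<close>. Writing \<open>s = l - K(w)\<close> with \<open>l\<close> slightly larger than \<open>1\<close>, which keeps \<open>s\<close> away from \<open>0\<close>,
  one maps \<open>z\<close> in this fibre to \<open>\<surd>s \<phi>(u)\<close>, where \<open>u = z / \<surd>s\<close>. Leaving \<open>w\<close> fixed would not be symplectic,
  since the map of the fibre varies with \<open>w\<close> through \<open>s\<close>.

  The defect is exact. With the Liouville form \<open>\<lambda>\<^sub>x(v) = \<omega>\<^sub>0(x, v) / 2\<close>, the closed form \<open>\<phi>\<^sup>*\<lambda> - \<lambda>\<close> has a primitive
  \<open>g\<close>, and the fibrewise map changes the Liouville form by \<open>s dg(u)\<close>. Rotating \<open>w\<close> by the flow
  of \<open>K\<close> for the time \<open>g(u)\<close> changes it by \<open>K dg(u)\<close>. The sum of the two is \<open>l dg(u)\<close>, which is exact, so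
  the combined map
  \<open>(z, w) \<mapsto> (\<surd>s \<phi>(u), e\<^sup>i\<^sup>\<theta> w)\<close> with \<open>\<theta>\<^sub>j = 2 \<pi> g(u) / a\<^sub>j\<close>
  is symplectic. It preserves \<open>K\<close>, which gives injectivity and the size of the image.

  The lemma \<open>liouville_primitive\<close> provides \<open>g\<close>, through a Poincare lemma and the symmetry of second
  derivatives; \<open>symplectic_\<psi>\<close> is the cancellation, carried out at the level of \<open>\<omega>\<^sub>0\<close>, where it involves
  first derivatives only; \<open>ellipsoid_embeds_extend\<close> assembles the embedding for an arbitrary
  injection of coordinate planes.
\<close>

section \<open>Closure properties of maps of class C^k\<close>

text \<open>
  Openness is what makes this true: derivatives at a point see only the values nearby, so on an
  open set two maps with equal values there have equal derivatives of all orders.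
\<close>

lemma Ck_on_cong:
  assumes "open U" and "\<And>x. x \<in> U \<Longrightarrow> f x = g x"
  shows "Ck_on k U f \<longleftrightarrow> Ck_on k U g"
proof -
  have imp: "Ck_on k U g" if "Ck_on k U f" "\<And>x. x \<in> U \<Longrightarrow> f x = g x" for f g
    using that
  proof (induction k arbitrary: f g)
    case 0
    then show ?case by (simp cong: continuous_on_cong)
  next
    case (Suc k)
    have der: "(g has_derivative frechet_derivative f (at x)) (at x)" if "x \<in> U" for x
      using Suc.prems that \<open>open U\<close>
      by (auto intro!: has_derivative_transform_within_open[of f _ x UNIV U g]
          simp: frechet_derivative_works)
    have "frechet_derivative f (at x) v = frechet_derivative g (at x) v" if "x \<in> U" for x v
      using frechet_derivative_at[OF der[OF that]] by simp
    then have "Ck_on k U (\<lambda>x. frechet_derivative g (at x) v)" for v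
      using Suc.prems(1) by (auto intro: Suc.IH)
    moreover have "g differentiable at x" if "x \<in> U" for x
      using der[OF that] by (auto simp: differentiable_def)
    ultimately show ?case by simp
  qed
  show ?thesis using imp[of f g] imp[of g f] assms(2) by auto
qed

text \<open>
  The introduction rule used throughout: by congruence, any known derivative may replace
  \<^const>\<open>frechet_derivative\<close>, so that most closure properties below become an induction on
  \<open>k\<close> whose step is a rule of differential calculus.
\<close>

lemma Ck_on_SucI:
  assumes "open U" and der: "\<And>x. x \<in> U \<Longrightarrow> (f has_derivative f' x) (at x)"
    and "\<And>v. Ck_on k U (\<lambda>x. f' x v)"
  shows "Ck_on (Suc k) U f"
proof -
  have "Ck_on k U (\<lambda>x. frechet_derivative f (at x) v)" for v
  proof (rule Ck_on_cong[THEN iffD1, OF \<open>open U\<close> _ assms(3)])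
    show "f' x v = frechet_derivative f (at x) v" if "x \<in> U" for x
      using frechet_derivative_at[OF der[OF that]] by simp
  qed
  then show ?thesis using der by (auto simp: differentiable_def)
qed

lemma Ck_on_Suc_has_derivative:
  assumes "Ck_on (Suc k) U f" "x \<in> U"
  shows "(f has_derivative frechet_derivative f (at x)) (at x)"
  using assms by (simp add: frechet_derivative_works)

lemma Ck_on_Suc_imp: "Ck_on (Suc k) U f \<Longrightarrow> Ck_on k U f"
proof (induction k arbitrary: f)
  case 0
  then show ?case
    by (auto intro!: continuous_at_imp_continuous_on differentiable_imp_continuous_within)
next
  case (Suc k)
  then show ?case by (metis Ck_on.simps(2))
qed

lemma Ck_on_subset: "Ck_on k U f \<Longrightarrow> V \<subseteq> U \<Longrightarrow> Ck_on k V f"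
  by (induction k arbitrary: f) (auto intro: continuous_on_subset)

lemma Ck_on_const: "Ck_on k U (\<lambda>x. c)"
  by (induction k arbitrary: c) auto

lemma Ck_on_linear:
  assumes "open U" "bounded_linear L" "Ck_on k U f"
  shows "Ck_on k U (\<lambda>x. L (f x))"
  using assms(3)
proof (induction k arbitrary: f)
  case 0
  then show ?case using bounded_linear.continuous_on[OF assms(2)] by auto
next
  case (Suc k)
  show ?case
  proof (rule Ck_on_SucI[OF \<open>open U\<close>])
    show "((\<lambda>x. L (f x)) has_derivative (\<lambda>v. L (frechet_derivative f (at x) v))) (at x)"
      if "x \<in> U" for x
      using bounded_linear.has_derivative[OF assms(2) Ck_on_Suc_has_derivative[OF Suc.prems that]] .
    show "Ck_on k U (\<lambda>x. L (frechet_derivative f (at x) v))" for v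
      using Suc by simp
  qed
qed

lemma Ck_on_id:
  assumes "open U"
  shows "Ck_on k U (\<lambda>x. x)"
proof (cases k)
  case (Suc j)
  then show ?thesis
    using Ck_on_SucI[where f' = "\<lambda>_ v. v" and f = "\<lambda>x. x", OF \<open>open U\<close> has_derivative_ident Ck_on_const]
    by simp
qed simp

lemma Ck_on_add:
  assumes "open U" "Ck_on k U f" "Ck_on k U g"
  shows "Ck_on k U (\<lambda>x. f x + g x)"
  using assms(2,3)
proof (induction k arbitrary: f g)
  case 0
  then show ?case by (auto intro: continuous_intros)
next
  case (Suc k)
  show ?case
  proof (rule Ck_on_SucI[OF \<open>open U\<close>])
    show "((\<lambda>x. f x + g x) has_derivative
        (\<lambda>v. frechet_derivative f (at x) v + frechet_derivative g (at x) v)) (at x)"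
      if "x \<in> U" for x
      using Suc.prems that by (intro has_derivative_add) (blast intro: Ck_on_Suc_has_derivative)+
    show "Ck_on k U (\<lambda>x. frechet_derivative f (at x) v + frechet_derivative g (at x) v)" for v
      using Suc by simp
  qed
qed

lemma Ck_on_diff:
  assumes "open U" "Ck_on k U f" "Ck_on k U g"
  shows "Ck_on k U (\<lambda>x. f x - g x)"
  using Ck_on_add[OF assms(1,2) Ck_on_linear[OF assms(1) bounded_linear_minus[OF bounded_linear_ident] assms(3)]]
  by simp

lemma Ck_on_sum:
  assumes "open U" "\<And>i. i \<in> I \<Longrightarrow> Ck_on k U (f i)"
  shows "Ck_on k U (\<lambda>x. \<Sum>i\<in>I. f i x)"
  using assms(2)
  by (induction I rule: infinite_finite_induct) (auto intro: Ck_on_const Ck_on_add \<open>open U\<close>)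

lemma Ck_on_bilinear:
  assumes "open U" and B: "bounded_bilinear B" and "Ck_on k U f" "Ck_on k U g"
  shows "Ck_on k U (\<lambda>x. B (f x) (g x))"
  using assms(3,4)
proof (induction k arbitrary: f g)
  case 0
  then show ?case using bounded_bilinear.continuous_on[OF B] by auto
next
  case (Suc k)
  show ?case
  proof (rule Ck_on_SucI[OF \<open>open U\<close>])
    show "((\<lambda>x. B (f x) (g x)) has_derivative
        (\<lambda>v. B (f x) (frechet_derivative g (at x) v) + B (frechet_derivative f (at x) v) (g x))) (at x)"
      if "x \<in> U" for x
      using Suc.prems that
      by (intro bounded_bilinear.FDERIV[OF B]) (blast intro: Ck_on_Suc_has_derivative)+
    show "Ck_on k U (\<lambda>x. B (f x) (frechet_derivative g (at x) v)
        + B (frechet_derivative f (at x) v) (g x))" for v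
      using Suc.prems Suc.prems[THEN Ck_on_Suc_imp] by (intro Ck_on_add \<open>open U\<close> Suc.IH) auto
  qed
qed

lemmas Ck_on_mult = Ck_on_bilinear[OF _ bounded_bilinear_mult]
lemmas Ck_on_scaleR = Ck_on_bilinear[OF _ bounded_bilinear_scaleR]

text \<open>
  The class \<^const>\<open>Ck_on\<close> controls derivatives in fixed directions only. Expanding in a basis
  reduces the derivative in a direction that moves with the point, as the chain rule produces,
  to finitely many fixed directions.
\<close>

lemma linear_eq_sum_Basis:
  fixes L :: "'a::euclidean_space \<Rightarrow> 'b::real_normed_vector"
  assumes "linear L"
  shows "L v = (\<Sum>b\<in>Basis. (v \<bullet> b) *\<^sub>R L b)"
proof -
  have "L (\<Sum>b\<in>Basis. (v \<bullet> b) *\<^sub>R b) = (\<Sum>b\<in>Basis. (v \<bullet> b) *\<^sub>R L b)"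
    by (simp add: linear_sum[OF assms] linear_cmul[OF assms] del: euclidean_representation)
  then show ?thesis by (simp add: euclidean_representation)
qed

lemma Ck_on_compose:
  fixes h :: "'a::real_normed_vector \<Rightarrow> 'b::euclidean_space"
  assumes "open U" "open V" "h ` U \<subseteq> V" "Ck_on k V f" "Ck_on k U h"
  shows "Ck_on k U (\<lambda>x. f (h x))"
  using assms(4,5)
proof (induction k arbitrary: f)
  case 0
  then show ?case using continuous_on_compose2 assms(3) by auto
next
  case (Suc k)
  have df: "(f has_derivative frechet_derivative f (at (h x))) (at (h x))" if "x \<in> U" for x
    using Suc.prems(1) assms(3) that by (blast intro: Ck_on_Suc_has_derivative)
  show ?case
  proof (rule Ck_on_SucI[OF \<open>open U\<close>])
    fix x assume x: "x \<in> U"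
    have "((\<lambda>x. f (h x)) has_derivative
        (\<lambda>v. frechet_derivative f (at (h x)) (frechet_derivative h (at x) v))) (at x)"
      using has_derivative_compose[OF Ck_on_Suc_has_derivative[OF Suc.prems(2) x] df[OF x]] .
    moreover have "(\<lambda>v. frechet_derivative f (at (h x)) (frechet_derivative h (at x) v))
        = (\<lambda>v. \<Sum>b\<in>Basis. (frechet_derivative h (at x) v \<bullet> b) *\<^sub>R frechet_derivative f (at (h x)) b)"
      using has_derivative_linear[OF df[OF x]] by (intro ext linear_eq_sum_Basis)
    ultimately show "((\<lambda>x. f (h x)) has_derivative
        (\<lambda>v. \<Sum>b\<in>Basis. (frechet_derivative h (at x) v \<bullet> b) *\<^sub>R frechet_derivative f (at (h x)) b)) (at x)"
      by simp
  next
    fix v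
    show "Ck_on k U (\<lambda>x. \<Sum>b\<in>Basis.
        (frechet_derivative h (at x) v \<bullet> b) *\<^sub>R frechet_derivative f (at (h x)) b)"
    proof (intro Ck_on_sum Ck_on_scaleR \<open>open U\<close>)
      fix b :: 'b
      show "Ck_on k U (\<lambda>x. frechet_derivative h (at x) v \<bullet> b)"
        by (rule Ck_on_linear[OF \<open>open U\<close> bounded_linear_inner_left]) (use Suc.prems(2) in simp)
      show "Ck_on k U (\<lambda>x. frechet_derivative f (at (h x)) b)"
        by (rule Suc.IH) (use Suc.prems Ck_on_Suc_imp in auto)
    qed
  qed
qed

lemma Ck_on_inverse: "Ck_on k {0<..} (inverse :: real \<Rightarrow> real)"
proof (induction k)
  case 0
  then show ?case by (auto intro!: continuous_intros)
next
  case (Suc k)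
  show ?case
  proof (rule Ck_on_SucI)
    show "(inverse has_derivative (\<lambda>v. - (inverse x * v * inverse x))) (at x)"
      if "x \<in> {0<..}" for x :: real
      using that by (auto intro!: derivative_eq_intros)
    have "Ck_on k {0<..} (\<lambda>x::real. (- v) * (inverse x * inverse x))" for v
      using Suc by (intro Ck_on_mult Ck_on_const) auto
    then show "Ck_on k {0<..} (\<lambda>x::real. - (inverse x * v * inverse x))" for v
      by (simp add: ac_simps)
  qed simp
qed

lemma Ck_on_sqrt: "Ck_on k {0<..} sqrt"
proof (induction k)
  case 0
  then show ?case by (auto intro!: continuous_intros)
next
  case (Suc k)
  show ?case
  proof (rule Ck_on_SucI)
    show "(sqrt has_derivative (\<lambda>v. (v / 2) * (sqrt x * inverse x))) (at x)"
      if "x \<in> {0<..}" for x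
      using that by (auto intro!: derivative_eq_intros simp: field_simps)
    show "Ck_on k {0<..} (\<lambda>x. (v / 2) * (sqrt x * inverse x))" for v :: real
      using Suc by (intro Ck_on_mult Ck_on_const Ck_on_inverse) auto
  qed simp
qed

text \<open>
  The two functions are treated together because each is, up to sign, the derivative of the other.
\<close>

lemma Ck_on_cos_sin: "Ck_on k UNIV (cos :: real \<Rightarrow> real) \<and> Ck_on k UNIV (sin :: real \<Rightarrow> real)"
proof (induction k)
  case 0
  then show ?case by (auto intro!: continuous_intros)
next
  case (Suc k)
  have "Ck_on (Suc k) UNIV (cos :: real \<Rightarrow> real)"
  proof (rule Ck_on_SucI)
    show "(cos has_derivative (\<lambda>v. (- v) * sin x)) (at x)" for x :: real
      by (auto intro!: derivative_eq_intros)
    show "Ck_on k UNIV (\<lambda>x. (- v) * sin x)" for v :: real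
      using Suc by (intro Ck_on_mult Ck_on_const) auto
  qed simp
  moreover have "Ck_on (Suc k) UNIV (sin :: real \<Rightarrow> real)"
  proof (rule Ck_on_SucI)
    show "(sin has_derivative (\<lambda>v. v * cos x)) (at x)" for x :: real
      by (auto intro!: derivative_eq_intros)
    show "Ck_on k UNIV (\<lambda>x. v * cos x)" for v :: real
      using Suc by (intro Ck_on_mult Ck_on_const) auto
  qed simp
  ultimately show ?case ..
qed

lemma vec_lambda_eq_sum_axis: "(\<chi> i. f i) = (\<Sum>i\<in>UNIV. f i *\<^sub>R axis i (1::real))"
  by (simp add: vec_eq_iff axis_def if_distrib[of "(*) _"] cong: if_cong)

lemma has_derivative_vec_lambda:
  fixes f :: "'a::real_normed_vector \<Rightarrow> 'n::finite \<Rightarrow> real"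
  assumes "\<And>i. ((\<lambda>x. f x i) has_derivative (\<lambda>v. f' v i)) F"
  shows "((\<lambda>x. \<chi> i. f x i) has_derivative (\<lambda>v. \<chi> i. f' v i)) F"
  unfolding vec_lambda_eq_sum_axis by (intro has_derivative_sum has_derivative_scaleR_left assms)

lemma Ck_on_vec_lambda:
  fixes f :: "'a::real_normed_vector \<Rightarrow> 'n::finite \<Rightarrow> real"
  assumes "open U" "\<And>i. Ck_on k U (\<lambda>x. f x i)"
  shows "Ck_on k U (\<lambda>x. \<chi> i. f x i)"
  unfolding vec_lambda_eq_sum_axis by (intro Ck_on_sum Ck_on_scaleR Ck_on_const assms)

lemma Ck_on_Pair:
  assumes "open U" "Ck_on k U f" "Ck_on k U g"
  shows "Ck_on k U (\<lambda>x. (f x, g x))"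
proof -
  have "bounded_linear (\<lambda>y. (y, 0))" "bounded_linear (\<lambda>y. (0, y))"
    by (simp_all add: bounded_linear_Pair bounded_linear_zero bounded_linear_ident)
  then have "Ck_on k U (\<lambda>x. (f x, 0) + (0, g x))"
    by (intro Ck_on_add assms(1) Ck_on_linear[OF assms(1) _ assms(2)] Ck_on_linear[OF assms(1) _ assms(3)])
  then show ?thesis by simp
qed

section \<open>Symmetry of second derivatives and primitives of closed one-forms\<close>

text \<open>
  The mean value theorem is applied twice, first to the difference
  \<open>r \<mapsto> f (x + r u + t v) - f (x + r u)\<close> and then to the first derivative along \<open>v\<close>.
  The left-hand side is symmetric in \<open>u\<close> and \<open>v\<close>, which gives the symmetry of second derivatives
  as \<open>t\<close> tends to \<open>0\<close>.
\<close>

lemma second_difference_eq_second_derivative: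
  fixes f :: "'a::real_normed_vector \<Rightarrow> real"
  assumes C2: "Ck_on 2 (ball x d) f" and "t > 0" and d: "t * (norm u + norm v) < d"
  shows "\<exists>y. dist x y \<le> t * (norm u + norm v) \<and>
    f (x + t *\<^sub>R u + t *\<^sub>R v) - f (x + t *\<^sub>R u) - f (x + t *\<^sub>R v) + f x
      = t\<^sup>2 * frechet_derivative (\<lambda>z. frechet_derivative f (at z) u) (at y) v"
proof -
  define D where "D = (\<lambda>z. frechet_derivative f (at z) u)"
  have C2': "Ck_on (Suc (Suc 0)) (ball x d) f" using C2 by (simp add: numeral_2_eq_2)
  have near: "dist x (x + r *\<^sub>R u + r' *\<^sub>R v) \<le> t * (norm u + norm v)"
    if "0 \<le> r" "r \<le> t" "0 \<le> r'" "r' \<le> t" for r r'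
  proof -
    have "dist x (x + r *\<^sub>R u + r' *\<^sub>R v) = norm (r *\<^sub>R u + r' *\<^sub>R v)"
      by (metis add.assoc add_diff_cancel_left' dist_commute dist_norm)
    also have "\<dots> \<le> r * norm u + r' * norm v"
      using norm_triangle_ineq[of "r *\<^sub>R u" "r' *\<^sub>R v"] that by simp
    also have "\<dots> \<le> t * norm u + t * norm v"
      using that by (intro add_mono mult_right_mono) auto
    finally show ?thesis by (simp add: algebra_simps)
  qed
  then have inb: "x + r *\<^sub>R u + r' *\<^sub>R v \<in> ball x d"
    if "0 \<le> r" "r \<le> t" "0 \<le> r'" "r' \<le> t" for r r'
    using d that by (meson le_less_trans mem_ball)
  have df: "(f has_derivative frechet_derivative f (at z)) (at z)" if "z \<in> ball x d" for z
    using Ck_on_Suc_has_derivative[OF C2' that] .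
  have dD: "(D has_derivative frechet_derivative D (at z)) (at z)" if "z \<in> ball x d" for z
    unfolding D_def using C2' that by (intro Ck_on_Suc_has_derivative[of 0 "ball x d"]) auto
  have lin: "linear (frechet_derivative f (at z))" if "z \<in> ball x d" for z
    using df[OF that] has_derivative_linear by blast
  define F where "F = (\<lambda>r. f (x + r *\<^sub>R u + t *\<^sub>R v) - f (x + r *\<^sub>R u))"
  have "\<exists>r\<in>{0<..<t}. F t - F 0 = (\<lambda>h. h * (D (x + r *\<^sub>R u + t *\<^sub>R v) - D (x + r *\<^sub>R u))) (t - 0)"
  proof (rule mvt_simple[OF \<open>t > 0\<close>])
    fix r assume r: "0 \<le> r" "r \<le> t"
    have a: "x + r *\<^sub>R u + t *\<^sub>R v \<in> ball x d" "x + r *\<^sub>R u \<in> ball x d"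
      using inb[of r t] inb[of r 0] r by auto
    have "(F has_derivative (\<lambda>h. frechet_derivative f (at (x + r *\<^sub>R u + t *\<^sub>R v)) (h *\<^sub>R u)
        - frechet_derivative f (at (x + r *\<^sub>R u)) (h *\<^sub>R u))) (at r)"
      unfolding F_def
      by (intro has_derivative_diff
          has_derivative_compose[of "\<lambda>r. x + r *\<^sub>R u + t *\<^sub>R v", OF _ df[OF a(1)]]
          has_derivative_compose[of "\<lambda>r. x + r *\<^sub>R u", OF _ df[OF a(2)]])
        (auto intro!: derivative_eq_intros)
    then show "(F has_derivative (\<lambda>h. h * (D (x + r *\<^sub>R u + t *\<^sub>R v) - D (x + r *\<^sub>R u)))) (at r within {0..t})"
      using lin[OF a(1)] lin[OF a(2)]
      by (simp add: linear_cmul D_def right_diff_distrib has_derivative_at_withinI)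
  qed
  then obtain r where r: "0 < r" "r < t"
    and Fr: "F t - F 0 = t * (D (x + r *\<^sub>R u + t *\<^sub>R v) - D (x + r *\<^sub>R u))" by auto
  have "\<exists>r'\<in>{0<..<t}. D (x + r *\<^sub>R u + t *\<^sub>R v) - D (x + r *\<^sub>R u + 0 *\<^sub>R v)
      = (\<lambda>h. frechet_derivative D (at (x + r *\<^sub>R u + r' *\<^sub>R v)) (h *\<^sub>R v)) (t - 0)"
  proof (rule mvt_simple[OF \<open>t > 0\<close>])
    fix r' assume r': "0 \<le> r'" "r' \<le> t"
    have a: "x + r *\<^sub>R u + r' *\<^sub>R v \<in> ball x d"
      using inb[of r r'] r r' by auto
    show "((\<lambda>r'. D (x + r *\<^sub>R u + r' *\<^sub>R v)) has_derivative
      (\<lambda>h. frechet_derivative D (at (x + r *\<^sub>R u + r' *\<^sub>R v)) (h *\<^sub>R v))) (at r' within {0..t})"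
      by (intro has_derivative_compose[of "\<lambda>r'. x + r *\<^sub>R u + r' *\<^sub>R v", OF _ dD[OF a]])
        (auto intro!: derivative_eq_intros)
  qed
  then obtain r' where r': "0 < r'" "r' < t"
    and Dr: "D (x + r *\<^sub>R u + t *\<^sub>R v) - D (x + r *\<^sub>R u)
       = frechet_derivative D (at (x + r *\<^sub>R u + r' *\<^sub>R v)) (t *\<^sub>R v)" by auto
  have "linear (frechet_derivative D (at (x + r *\<^sub>R u + r' *\<^sub>R v)))"
    using dD inb[of r r'] r r' has_derivative_linear by fastforce
  then have "F t - F 0 = t\<^sup>2 * frechet_derivative D (at (x + r *\<^sub>R u + r' *\<^sub>R v)) v"
    unfolding Fr Dr by (simp add: linear_cmul power2_eq_square)
  moreover have "F t - F 0 = f (x + t *\<^sub>R u + t *\<^sub>R v) - f (x + t *\<^sub>R u) - f (x + t *\<^sub>R v) + f x"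
    by (simp add: F_def)
  ultimately show ?thesis
    using near[of r r'] r r' unfolding D_def by (metis less_imp_le)
qed

text \<open>
  Both mixed derivatives at \<open>x\<close> are within any \<open>e / 2\<close> of the same second difference quotient.
\<close>

lemma symmetric_second_derivative_real:
  fixes f :: "'a::real_normed_vector \<Rightarrow> real"
  assumes "open U" "x \<in> U" "Ck_on 2 U f"
  shows "frechet_derivative (\<lambda>z. frechet_derivative f (at z) u) (at x) v
       = frechet_derivative (\<lambda>z. frechet_derivative f (at z) v) (at x) u"
proof -
  define E where "E = (\<lambda>u v y. frechet_derivative (\<lambda>z. frechet_derivative f (at z) u) (at y) v)"
  have cont: "isCont (E u v) x" for u v
    using assms unfolding E_def
    by (simp add: numeral_2_eq_2 continuous_on_eq_continuous_at)
  have "\<bar>E u v x - E v u x\<bar> \<le> e" if "e > 0" for e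
  proof -
    obtain d0 where d0: "d0 > 0" "ball x d0 \<subseteq> U"
      using assms open_contains_ball by blast
    have near: "\<exists>r>0. \<forall>y. dist y x < r \<longrightarrow> \<bar>E u v y - E u v x\<bar> < e / 2" for u v
      using cont[of u v] that unfolding continuous_at_eps_delta dist_real_def
      by (metis half_gt_zero)
    obtain r s where "r > 0" "s > 0"
      and "\<And>y. dist y x < r \<Longrightarrow> \<bar>E u v y - E u v x\<bar> < e / 2"
      and "\<And>y. dist y x < s \<Longrightarrow> \<bar>E v u y - E v u x\<bar> < e / 2"
      using near[of u v] near[of v u] by metis
    then obtain d1 where d1: "d1 > 0"
      and E: "\<And>y. dist y x < d1 \<Longrightarrow> \<bar>E u v y - E u v x\<bar> < e / 2 \<and> \<bar>E v u y - E v u x\<bar> < e / 2"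
      by (metis min_less_iff_conj)
    define d where "d = min d0 d1"
    \<comment> \<open>The summand 1 makes the bound on the step strict, and covers the case of two zero directions.\<close>
    define t where "t = d / (norm u + norm v + 1)"
    have d: "d > 0" using d0 d1 by (simp add: d_def)
    have n: "norm u + norm v + 1 > 0" using norm_ge_zero[of u] norm_ge_zero[of v] by linarith
    have t: "t > 0" "t * (norm u + norm v) < d" "t * (norm v + norm u) < d"
      using d n by (auto simp: t_def field_simps)
    have C2: "Ck_on 2 (ball x d) f"
      using assms(3) by (rule Ck_on_subset) (use d0 in \<open>auto simp: d_def\<close>)
    obtain y where y: "dist x y \<le> t * (norm u + norm v)"
      "f (x + t *\<^sub>R u + t *\<^sub>R v) - f (x + t *\<^sub>R u) - f (x + t *\<^sub>R v) + f x = t\<^sup>2 * E u v y"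
      unfolding E_def using second_difference_eq_second_derivative[OF C2 t(1,2)] by auto
    obtain y' where y': "dist x y' \<le> t * (norm v + norm u)"
      "f (x + t *\<^sub>R v + t *\<^sub>R u) - f (x + t *\<^sub>R v) - f (x + t *\<^sub>R u) + f x = t\<^sup>2 * E v u y'"
      unfolding E_def using second_difference_eq_second_derivative[OF C2 t(1,3)] by auto
    have "t\<^sup>2 * E u v y = t\<^sup>2 * E v u y'"
      using y(2) y'(2) by (simp add: algebra_simps)
    then have "E u v y = E v u y'" using t by simp
    moreover have "dist y x < d1" "dist y' x < d1"
      using y(1) y'(1) t by (auto simp: d_def dist_commute)
    ultimately show ?thesis using E[of y] E[of y'] by linarith
  qed
  then have "E u v x = E v u x"
    by (metis abs_le_zero_iff eq_iff_diff_eq_0 field_le_epsilon add_0)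
  then show ?thesis unfolding E_def .
qed

lemma symmetric_second_derivative:
  fixes f :: "'a::real_normed_vector \<Rightarrow> 'b::euclidean_space"
  assumes "open U" "x \<in> U" "Ck_on 2 U f"
  shows "frechet_derivative (\<lambda>z. frechet_derivative f (at z) u) (at x) v
       = frechet_derivative (\<lambda>z. frechet_derivative f (at z) v) (at x) u"
proof (rule euclidean_eqI)
  fix b :: 'b
  have C: "Ck_on (Suc (Suc 0)) U f" using assms(3) by (simp add: numeral_2_eq_2)
  have 1: "((\<lambda>z. f z \<bullet> b) has_derivative (\<lambda>v. frechet_derivative f (at y) v \<bullet> b)) (at y)"
    if "y \<in> U" for y
    using has_derivative_inner_left[OF Ck_on_Suc_has_derivative[OF C that]] .
  have 2: "frechet_derivative (\<lambda>z. f z \<bullet> b) (at y) v = frechet_derivative f (at y) v \<bullet> b"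
    if "y \<in> U" for y v
    using frechet_derivative_at[OF 1[OF that]] by metis
  have 3: "frechet_derivative (\<lambda>z. frechet_derivative (\<lambda>z. f z \<bullet> b) (at z) u) (at x) v
      = frechet_derivative (\<lambda>z. frechet_derivative f (at z) u) (at x) v \<bullet> b" for u v
  proof -
    have "((\<lambda>z. frechet_derivative f (at z) u \<bullet> b) has_derivative
        (\<lambda>v. frechet_derivative (\<lambda>z. frechet_derivative f (at z) u) (at x) v \<bullet> b)) (at x)"
      using C assms(2) by (intro has_derivative_inner_left Ck_on_Suc_has_derivative[of 0 U]) auto
    then have "((\<lambda>z. frechet_derivative (\<lambda>z. f z \<bullet> b) (at z) u) has_derivative
        (\<lambda>v. frechet_derivative (\<lambda>z. frechet_derivative f (at z) u) (at x) v \<bullet> b)) (at x)"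
      by (rule has_derivative_transform_within_open[OF _ assms(1,2)]) (simp add: 2)
    from frechet_derivative_at[OF this] show ?thesis by metis
  qed
  have "Ck_on 2 U (\<lambda>z. f z \<bullet> b)"
    using Ck_on_linear[OF assms(1) bounded_linear_inner_left assms(3)] .
  from symmetric_second_derivative_real[OF assms(1,2) this, of u v]
  show "frechet_derivative (\<lambda>z. frechet_derivative f (at z) u) (at x) v \<bullet> b
      = frechet_derivative (\<lambda>z. frechet_derivative f (at z) v) (at x) u \<bullet> b"
    unfolding 3 .
qed

text \<open>
  The Poincare lemma for one-forms. The primitive is the integral of the form along rays,
  \<open>g x = \<integral>\<^sub>0\<^sup>1 \<alpha> (t x) x dt\<close>. Differentiating under the integral sign and exchanging the two
  arguments of the derivative of \<open>\<alpha>\<close> by closedness turns the integrand into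
  \<open>d/dt (t \<alpha> (t x) v)\<close>, whose integral is \<open>\<alpha> x v\<close>.
\<close>

lemma primitive_of_closed_form:
  fixes \<alpha> :: "'a::euclidean_space \<Rightarrow> 'a \<Rightarrow> real"
  assumes B: "open B" "convex B" "0 \<in> B"
    and lin: "\<And>x. x \<in> B \<Longrightarrow> linear (\<alpha> x)"
    and C1: "\<And>v. Ck_on 1 B (\<lambda>x. \<alpha> x v)"
    and closed: "\<And>x u v. x \<in> B \<Longrightarrow>
      frechet_derivative (\<lambda>z. \<alpha> z u) (at x) v = frechet_derivative (\<lambda>z. \<alpha> z v) (at x) u"
  obtains g where "\<And>x. x \<in> B \<Longrightarrow> (g has_derivative \<alpha> x) (at x)"
proof -
  define D where "D = (\<lambda>b x. frechet_derivative (\<lambda>z. \<alpha> z b) (at x))"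
  \<comment> \<open>The function \<open>h b x\<close> is the derivative of \<open>t \<mapsto> t \<alpha> (t x) b\<close>.\<close>
  define h where "h = (\<lambda>b x t. \<alpha> (t *\<^sub>R x) b + t * D b (t *\<^sub>R x) x)"
  define fx where "fx = (\<lambda>x t. \<Sum>b\<in>Basis. h b x t *\<^sub>R (blinfun_inner_left b :: 'a \<Rightarrow>\<^sub>L real))"
  define g where "g = (\<lambda>x. integral (cbox 0 1) (\<lambda>t. \<alpha> (t *\<^sub>R x) x))"
  have tx: "t *\<^sub>R x \<in> B" if "x \<in> B" "t \<in> {0..1}" for x t
    using convexD_alt[OF B(2) B(3) that(1), of t] that(2) by simp
  have C1': "Ck_on (Suc 0) B (\<lambda>x. \<alpha> x v)" for v
    using C1[of v] by simp
  have der: "((\<lambda>z. \<alpha> z b) has_derivative D b x) (at x)" if "x \<in> B" for b x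
    unfolding D_def using Ck_on_Suc_has_derivative[OF C1' that] .
  have linD: "linear (D b x)" if "x \<in> B" for b x
    using has_derivative_linear[OF der[OF that]] .
  have ca: "continuous_on B (\<lambda>x. \<alpha> x b)" for b
    using Ck_on_Suc_imp[OF C1'] by simp
  have cD: "continuous_on B (\<lambda>x. D b x v)" for b v
    using C1'[of b] by (simp add: D_def)
  have ch: "continuous_on (B \<times> {0..1}) (\<lambda>(x, t). h b x t)" for b
  proof -
    have "continuous_on (B \<times> {0..1}) (\<lambda>p. \<alpha> (snd p *\<^sub>R fst p) b
        + snd p * (\<Sum>c\<in>Basis. (fst p \<bullet> c) *\<^sub>R D b (snd p *\<^sub>R fst p) c))"
      by (intro continuous_intros continuous_on_compose2[OF ca] continuous_on_compose2[OF cD])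
        (auto intro: tx)
    then show ?thesis
    proof (rule continuous_on_eq)
      fix p assume p: "p \<in> B \<times> {0..1::real}"
      then have "linear (D b (snd p *\<^sub>R fst p))" by (intro linD) (auto intro!: tx)
      from linear_eq_sum_Basis[OF this, of "fst p"] show "\<alpha> (snd p *\<^sub>R fst p) b
        + snd p * (\<Sum>c\<in>Basis. (fst p \<bullet> c) *\<^sub>R D b (snd p *\<^sub>R fst p) c) = (case p of (x, t) \<Rightarrow> h b x t)"
        by (simp add: h_def split_beta)
    qed
  qed
  have expand: "\<alpha> (t *\<^sub>R x) x = (\<Sum>b\<in>Basis. (x \<bullet> b) * \<alpha> (t *\<^sub>R x) b)" if "x \<in> B" "t \<in> {0..1}" for x t
    using linear_eq_sum_Basis[OF lin[OF tx[OF that]], of x] by simp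
  have der_fx: "((\<lambda>x. \<alpha> (t *\<^sub>R x) x) has_derivative blinfun_apply (fx x t)) (at x within B)"
    if x: "x \<in> B" and t: "t \<in> cbox 0 1" for x t
  proof -
    have t': "t \<in> {0..1}" using t by simp
    have d1: "((\<lambda>x. \<alpha> (t *\<^sub>R x) b) has_derivative (\<lambda>v. D b (t *\<^sub>R x) (t *\<^sub>R v))) (at x)" for b
      by (rule has_derivative_compose[where f = "\<lambda>x. t *\<^sub>R x" and g = "\<lambda>z. \<alpha> z b",
            OF _ der[OF tx[OF x t']]]) (auto intro!: derivative_eq_intros)
    have "((\<lambda>x. \<Sum>b\<in>Basis. (x \<bullet> b) * \<alpha> (t *\<^sub>R x) b) has_derivative
        (\<lambda>v. \<Sum>b\<in>Basis. (x \<bullet> b) * D b (t *\<^sub>R x) (t *\<^sub>R v) + (v \<bullet> b) * \<alpha> (t *\<^sub>R x) b)) (at x)"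
      by (intro has_derivative_sum has_derivative_mult d1 has_derivative_inner_left has_derivative_ident)
    moreover have "(\<Sum>b\<in>Basis. (x \<bullet> b) * D b (t *\<^sub>R x) (t *\<^sub>R v) + (v \<bullet> b) * \<alpha> (t *\<^sub>R x) b)
        = blinfun_apply (fx x t) v" for v
    proof -
      have "D b (t *\<^sub>R x) (t *\<^sub>R v) = t * (\<Sum>c\<in>Basis. (v \<bullet> c) * D c (t *\<^sub>R x) b)" for b
      proof -
        have "D b (t *\<^sub>R x) c = D c (t *\<^sub>R x) b" for c
          unfolding D_def by (rule closed[OF tx[OF x t']])
        then show ?thesis
          using linear_eq_sum_Basis[OF linD[OF tx[OF x t']], of b v]
          by (simp add: linear_cmul[OF linD[OF tx[OF x t']]])
      qed
      then have "(\<Sum>b\<in>Basis. (x \<bullet> b) * D b (t *\<^sub>R x) (t *\<^sub>R v))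
          = (\<Sum>b\<in>Basis. \<Sum>c\<in>Basis. t * ((x \<bullet> b) * ((v \<bullet> c) * D c (t *\<^sub>R x) b)))"
        by (simp add: sum_distrib_left mult.left_commute)
      also have "\<dots> = (\<Sum>c\<in>Basis. \<Sum>b\<in>Basis. t * ((x \<bullet> b) * ((v \<bullet> c) * D c (t *\<^sub>R x) b)))"
        by (rule sum.swap)
      also have "\<dots> = (\<Sum>c\<in>Basis. (v \<bullet> c) * (t * D c (t *\<^sub>R x) x))"
        using linear_eq_sum_Basis[OF linD[OF tx[OF x t']], of _ x]
        by (intro sum.cong refl) (simp add: sum_distrib_left ac_simps)
      finally show ?thesis
        by (simp add: fx_def h_def blinfun.sum_left blinfun.scaleR_left sum.distrib
            distrib_left distrib_right inner_commute mult.commute add.commute)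
    qed
    ultimately have "((\<lambda>x. \<Sum>b\<in>Basis. (x \<bullet> b) * \<alpha> (t *\<^sub>R x) b) has_derivative
        blinfun_apply (fx x t)) (at x)" by simp
    then have "((\<lambda>x. \<alpha> (t *\<^sub>R x) x) has_derivative blinfun_apply (fx x t)) (at x)"
      by (rule has_derivative_transform_within_open[OF _ B(1) x]) (simp add: expand[OF _ t'])
    then show ?thesis by (rule has_derivative_at_withinI)
  qed
  have int_h: "(h b x has_integral \<alpha> x b) {0..1}" if x: "x \<in> B" for b x
  proof -
    have "((\<lambda>t. t * \<alpha> (t *\<^sub>R x) b) has_vector_derivative h b x t) (at t within {0..1})"
      if t: "0 \<le> t" "t \<le> 1" for t
    proof -
      have txB: "t *\<^sub>R x \<in> B" using tx[OF x] t by simp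
      have "((\<lambda>t. \<alpha> (t *\<^sub>R x) b) has_derivative (\<lambda>k. D b (t *\<^sub>R x) (k *\<^sub>R x))) (at t)"
        by (rule has_derivative_compose[where f = "\<lambda>t. t *\<^sub>R x" and g = "\<lambda>z. \<alpha> z b",
              OF _ der[OF txB]]) (auto intro!: derivative_eq_intros)
      then have "((\<lambda>t. t * \<alpha> (t *\<^sub>R x) b) has_derivative
          (\<lambda>k. t * D b (t *\<^sub>R x) (k *\<^sub>R x) + k * \<alpha> (t *\<^sub>R x) b)) (at t)"
        by (intro has_derivative_mult has_derivative_ident)
      then show ?thesis
        unfolding has_vector_derivative_def
        by (rule has_derivative_at_withinI[THEN has_derivative_eq_rhs])
          (simp add: linear_cmul[OF linD[OF txB]] h_def algebra_simps)
    qed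
    then have "(h b x has_integral 1 * \<alpha> (1 *\<^sub>R x) b - 0 * \<alpha> (0 *\<^sub>R x) b) {0..1}"
      by (intro fundamental_theorem_of_calculus) auto
    then show ?thesis by simp
  qed
  have "(g has_derivative \<alpha> x) (at x)" if x: "x \<in> B" for x
  proof -
    have "(g has_derivative integral (cbox 0 1) (fx x)) (at x within B)"
      unfolding g_def
    proof (rule leibniz_rule[OF der_fx _ _ x B(2)])
      show "(\<lambda>t. \<alpha> (t *\<^sub>R y) y) integrable_on cbox 0 1" if "y \<in> B" for y
      proof -
        have "continuous_on {0..1} (\<lambda>t. \<Sum>b\<in>Basis. (y \<bullet> b) * \<alpha> (t *\<^sub>R y) b)"
          by (intro continuous_intros continuous_on_compose2[OF ca]) (auto intro: tx that)
        then have "continuous_on {0..1} (\<lambda>t. \<alpha> (t *\<^sub>R y) y)"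
          by (rule continuous_on_eq) (simp add: expand[OF that])
        then show ?thesis by (intro integrable_continuous) simp
      qed
      show "continuous_on (B \<times> cbox 0 1) (\<lambda>(x, t). fx x t)"
        using ch unfolding fx_def by (auto simp: split_beta intro!: continuous_intros)
    qed
    moreover have "(fx x has_integral (\<Sum>b\<in>Basis. \<alpha> x b *\<^sub>R blinfun_inner_left b)) {0..1}"
      unfolding fx_def by (intro has_integral_sum has_integral_scaleR_left int_h x) auto
    then have "integral (cbox 0 1) (fx x) = (\<Sum>b\<in>Basis. \<alpha> x b *\<^sub>R blinfun_inner_left b)"
      by (simp add: integral_unique)
    moreover have "blinfun_apply (\<Sum>b\<in>Basis. \<alpha> x b *\<^sub>R blinfun_inner_left b) = \<alpha> x"
    proof
      fix v show "blinfun_apply (\<Sum>b\<in>Basis. \<alpha> x b *\<^sub>R blinfun_inner_left b) v = \<alpha> x v"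
        using linear_eq_sum_Basis[OF lin[OF x], of v]
        by (simp add: blinfun.sum_left blinfun.scaleR_left inner_commute mult.commute)
    qed
    ultimately show ?thesis using at_within_open[OF x B(1)] by simp
  qed
  then show thesis using that by blast
qed

section \<open>The standard symplectic form and the Liouville form\<close>

lemma bounded_bilinear_omega: "bounded_bilinear (\<omega>\<^sub>0 :: (real^'n) \<times> (real^'n) \<Rightarrow> _ \<Rightarrow> real)"
  unfolding bilinear_conv_bounded_bilinear[symmetric] bilinear_def
  by (auto intro!: linearI simp: \<omega>\<^sub>0_def algebra_simps sum.distrib sum_subtractf sum_distrib_left)

lemma omega_antisym: "\<omega>\<^sub>0 v u = - \<omega>\<^sub>0 u v"
  by (simp add: \<omega>\<^sub>0_def sum_subtractf mult.commute)

text \<open>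
  The form is nondegenerate: \<open>u\<close> is paired with its rotation by a right angle in every coordinate
  plane to give the squared norm of \<open>u\<close>.
\<close>

lemma inj_of_symplectic:
  fixes L :: "(real^'n) \<times> (real^'n) \<Rightarrow> (real^'n) \<times> (real^'n)"
  assumes "linear L" "\<And>u v. \<omega>\<^sub>0 (L u) (L v) = \<omega>\<^sub>0 u v"
  shows "inj L"
proof -
  have "u = 0" if "L u = 0" for u
  proof -
    have "0 = \<omega>\<^sub>0 u (- snd u, fst u)"
      using assms(2)[of u "(- snd u, fst u)"] that by (simp add: \<omega>\<^sub>0_def)
    also have "\<dots> = (\<Sum>i\<in>UNIV. (fst u $ i)\<^sup>2 + (snd u $ i)\<^sup>2)"
      by (simp add: \<omega>\<^sub>0_def power2_eq_square)
    finally have "\<forall>i. (fst u $ i)\<^sup>2 + (snd u $ i)\<^sup>2 = 0"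
      by (simp add: sum_nonneg_eq_0_iff)
    then show "u = 0" by (simp add: prod_eq_iff vec_eq_iff sum_power2_eq_zero_iff)
  qed
  then show ?thesis using linear_injective_0[OF assms(1)] by blast
qed

text \<open>
  The one-form \<open>\<lambda>\<^sub>x v = \<omega>\<^sub>0 x v / 2\<close> is a primitive of \<open>\<omega>\<^sub>0\<close>, so a symplectic map \<open>\<phi>\<close> changes it by
  a closed form, which on a convex set is the differential of a function \<open>g\<close>. Concretely, the
  derivative of \<open>\<phi>\<^sup>*\<lambda> - \<lambda>\<close> is \<open>\<omega>\<^sub>0 (\<phi> x) (D\<^sup>2\<phi> (u, v)) / 2\<close> once the first-order terms have
  cancelled by symplecticity, and this is symmetric in \<open>u\<close> and \<open>v\<close>.
\<close>

lemma liouville_primitive: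
  fixes \<phi> :: "(real^'n) \<times> (real^'n) \<Rightarrow> (real^'n) \<times> (real^'n)"
  assumes B: "open B" "convex B" "0 \<in> B" and sm: "smooth_on B \<phi>"
    and sym: "\<And>x u v. x \<in> B \<Longrightarrow>
      \<omega>\<^sub>0 (frechet_derivative \<phi> (at x) u) (frechet_derivative \<phi> (at x) v) = \<omega>\<^sub>0 u v"
  obtains g where "smooth_on B g"
    "\<And>x. x \<in> B \<Longrightarrow>
      (g has_derivative (\<lambda>v. (\<omega>\<^sub>0 (\<phi> x) (frechet_derivative \<phi> (at x) v) - \<omega>\<^sub>0 x v) / 2)) (at x)"
proof -
  interpret \<omega>: bounded_bilinear "\<omega>\<^sub>0 :: (real^'n) \<times> (real^'n) \<Rightarrow> _ \<Rightarrow> real"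
    by (rule bounded_bilinear_omega)
  define D where "D = (\<lambda>x. frechet_derivative \<phi> (at x))"
  define \<alpha> where "\<alpha> = (\<lambda>x v. (\<omega>\<^sub>0 (\<phi> x) (D x v) - \<omega>\<^sub>0 x v) / 2)"
  have C: "Ck_on k B \<phi>" for k using sm by (simp add: smooth_on_def)
  have CD: "Ck_on k B (\<lambda>x. D x v)" for k v
    using C[of "Suc k"] unfolding D_def Ck_on.simps by blast
  have der: "(\<phi> has_derivative D x) (at x)" if "x \<in> B" for x
    unfolding D_def using Ck_on_Suc_has_derivative[OF C that] .
  have C\<alpha>: "Ck_on k B (\<lambda>x. \<alpha> x v)" for k v
  proof -
    have "Ck_on k B (\<lambda>x. (1/2) * (\<omega>\<^sub>0 (\<phi> x) (D x v) + \<omega>\<^sub>0 x (- v)))"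
      by (intro Ck_on_mult Ck_on_add Ck_on_bilinear[OF _ bounded_bilinear_omega] Ck_on_const
          Ck_on_id C CD B(1))
    then show ?thesis by (simp add: \<alpha>_def \<omega>.minus_right)
  qed
  have lin: "linear (\<alpha> x)" if "x \<in> B" for x
    using has_derivative_linear[OF der[OF that]]
    by (intro linearI) (simp_all add: \<alpha>_def linear_add linear_cmul \<omega>.add_right \<omega>.scaleR_right
        algebra_simps add_divide_distrib diff_divide_distrib)
  have closed: "frechet_derivative (\<lambda>z. \<alpha> z u) (at x) v = frechet_derivative (\<lambda>z. \<alpha> z v) (at x) u"
    if x: "x \<in> B" for x u v
  proof -
    have *: "frechet_derivative (\<lambda>z. \<alpha> z u) (at x) v
      = \<omega>\<^sub>0 (\<phi> x) (frechet_derivative (\<lambda>z. D z u) (at x) v) / 2" for u v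
    proof -
      have "((\<lambda>z. D z u) has_derivative frechet_derivative (\<lambda>z. D z u) (at x)) (at x)"
        using Ck_on_Suc_has_derivative[OF CD x] .
      then have "((\<lambda>z. (1/2) * (\<omega>\<^sub>0 (\<phi> z) (D z u) - \<omega>\<^sub>0 z u)) has_derivative
        (\<lambda>v. (1/2) * ((\<omega>\<^sub>0 (\<phi> x) (frechet_derivative (\<lambda>z. D z u) (at x) v) + \<omega>\<^sub>0 (D x v) (D x u))
          - \<omega>\<^sub>0 v u))) (at x)"
        by (intro has_derivative_mult_right has_derivative_diff \<omega>.FDERIV der x
            bounded_linear.has_derivative[OF \<omega>.bounded_linear_left] has_derivative_ident)
      from frechet_derivative_at[OF this, THEN fun_cong, of v] show ?thesis
        using sym[OF x] by (simp add: \<alpha>_def D_def)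
    qed
    show ?thesis
      unfolding * using symmetric_second_derivative[OF B(1) x C] by (simp add: D_def)
  qed
  obtain g where g: "\<And>x. x \<in> B \<Longrightarrow> (g has_derivative \<alpha> x) (at x)"
    using primitive_of_closed_form[OF B lin C\<alpha> closed] by blast
  have "Ck_on (Suc k) B g" for k
    by (rule Ck_on_SucI[OF B(1) g C\<alpha>])
  then have "smooth_on B g" unfolding smooth_on_def using Ck_on_Suc_imp by blast
  then show thesis using that g unfolding \<alpha>_def D_def by blast
qed

section \<open>Weighted areas and the rotations that they generate\<close>

definition weighted_area :: "'n set \<Rightarrow> ('n::finite \<Rightarrow> real) \<Rightarrow> (real^'n) \<times> (real^'n) \<Rightarrow> real"
  where "weighted_area S a p = (\<Sum>i\<in>S. pi * ((fst p $ i)\<^sup>2 + (snd p $ i)\<^sup>2) / a i)"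

text \<open>
  The Hamiltonian flow of \<open>weighted_area S a\<close> at time \<open>t\<close>, composed with the projection that
  annihilates the coordinate planes outside \<open>S\<close>.
\<close>

definition rotation :: "'n set \<Rightarrow> ('n::finite \<Rightarrow> real) \<Rightarrow> real \<Rightarrow> (real^'n) \<times> (real^'n) \<Rightarrow> (real^'n) \<times> (real^'n)"
  where "rotation S a t p =
    (\<chi> i. if i \<in> S then cos (2 * pi / a i * t) * fst p $ i - sin (2 * pi / a i * t) * snd p $ i else 0,
     \<chi> i. if i \<in> S then sin (2 * pi / a i * t) * fst p $ i + cos (2 * pi / a i * t) * snd p $ i else 0)"

definition rotation_field :: "'n set \<Rightarrow> ('n::finite \<Rightarrow> real) \<Rightarrow> (real^'n) \<times> (real^'n) \<Rightarrow> (real^'n) \<times> (real^'n)"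
  where "rotation_field S a p =
    (\<chi> i. if i \<in> S then - (2 * pi / a i * snd p $ i) else 0,
     \<chi> i. if i \<in> S then 2 * pi / a i * fst p $ i else 0)"

lemma ellipsoid_eq_weighted_area: "ellipsoid a = {p. weighted_area UNIV a p \<le> 1}"
  by (auto simp: ellipsoid_def weighted_area_def)

lemma weighted_area_nonneg: "(\<And>i. i \<in> S \<Longrightarrow> a i > 0) \<Longrightarrow> weighted_area S a p \<ge> 0"
  unfolding weighted_area_def by (intro sum_nonneg) (simp add: less_imp_le)

lemma weighted_area_scaleR: "weighted_area S a (c *\<^sub>R p) = c\<^sup>2 * weighted_area S a p"
  by (simp add: weighted_area_def sum_distrib_left power_mult_distrib algebra_simps)

lemma weighted_area_scale_weights: "weighted_area S (\<lambda>i. c * a i) p = weighted_area S a p / c"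
  by (simp add: weighted_area_def sum_divide_distrib mult.commute)

text \<open>
  Hence \<^const>\<open>rotation_field\<close> is the Hamiltonian vector field of \<^const>\<open>weighted_area\<close>, with this
  sign convention. It is this relation that fixes the speed \<open>2 \<pi> / a i\<close> of the rotation.
\<close>

lemma has_derivative_weighted_area:
  "(weighted_area S a has_derivative (\<lambda>v. \<omega>\<^sub>0 v (rotation_field S a p))) (at p)"
proof -
  have "(weighted_area S a has_derivative
    (\<lambda>v. \<Sum>i\<in>S. pi * (2 * (fst p $ i) * fst v $ i + 2 * (snd p $ i) * snd v $ i) / a i)) (at p)"
    unfolding weighted_area_def
    by (intro has_derivative_sum)
       (auto intro!: derivative_eq_intros bounded_linear.has_derivative[OF bounded_linear_vec_nth]
         simp: divide_inverse algebra_simps)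
  moreover have "(\<Sum>i\<in>S. pi * (2 * (fst p $ i) * fst v $ i + 2 * (snd p $ i) * snd v $ i) / a i)
      = \<omega>\<^sub>0 v (rotation_field S a p)" for v
    unfolding \<omega>\<^sub>0_def rotation_field_def
    by (rule sum.mono_neutral_cong_left) (auto simp: algebra_simps add_divide_distrib)
  ultimately show ?thesis by simp
qed

lemma Ck_on_weighted_area: "open U \<Longrightarrow> Ck_on k U (weighted_area S a)"
proof -
  assume U: "open U"
  have "Ck_on k U (\<lambda>p. \<Sum>i\<in>S. pi / a i * (fst p $ i * fst p $ i + snd p $ i * snd p $ i))"
    by (intro Ck_on_sum Ck_on_mult Ck_on_add Ck_on_const U
        Ck_on_linear[OF U bounded_linear_vec_nth] Ck_on_linear[OF U bounded_linear_fst]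
        Ck_on_linear[OF U bounded_linear_snd] Ck_on_id)
  then show ?thesis
    by (simp add: weighted_area_def[abs_def] power2_eq_square)
qed

lemma continuous_on_weighted_area: "continuous_on U (weighted_area S a)"
  using Ck_on_subset[OF Ck_on_weighted_area[OF open_UNIV, of 0], of U] by simp

text \<open>
  Convexity comes from that of the square,
  \<open>u x\<^sup>2 + v y\<^sup>2 - (u x + v y)\<^sup>2 = u v (x - y)\<^sup>2\<close> whenever \<open>u + v = 1\<close>.
\<close>

lemma convex_weighted_area_less:
  assumes "\<And>i. i \<in> S \<Longrightarrow> a i > 0"
  shows "convex {p. weighted_area S a p < c}"
proof (rule convexI)
  fix p q and u v :: real
  assume pq: "p \<in> {p. weighted_area S a p < c}" "q \<in> {p. weighted_area S a p < c}"
    and uv: "0 \<le> u" "0 \<le> v" "u + v = 1"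
  have sq: "(u * x + v * y)\<^sup>2 \<le> u * x\<^sup>2 + v * y\<^sup>2" for x y :: real
  proof -
    have "u = 1 - v" using uv(3) by simp
    have "u * x\<^sup>2 + v * y\<^sup>2 - (u * x + v * y)\<^sup>2 = u * v * (x - y)\<^sup>2"
      unfolding \<open>u = 1 - v\<close> by (simp add: power2_eq_square algebra_simps)
    then show ?thesis using uv by (smt (verit) mult_nonneg_nonneg zero_le_power2)
  qed
  have "weighted_area S a (u *\<^sub>R p + v *\<^sub>R q) \<le> (\<Sum>i\<in>S. u * (pi * ((fst p $ i)\<^sup>2 + (snd p $ i)\<^sup>2) / a i)
      + v * (pi * ((fst q $ i)\<^sup>2 + (snd q $ i)\<^sup>2) / a i))"
    unfolding weighted_area_def
  proof (intro sum_mono)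
    fix i assume "i \<in> S"
    then have ai: "a i > 0" by (rule assms)
    have "(fst (u *\<^sub>R p + v *\<^sub>R q) $ i)\<^sup>2 + (snd (u *\<^sub>R p + v *\<^sub>R q) $ i)\<^sup>2
      \<le> u * ((fst p $ i)\<^sup>2 + (snd p $ i)\<^sup>2) + v * ((fst q $ i)\<^sup>2 + (snd q $ i)\<^sup>2)"
      using sq[of "fst p $ i" "fst q $ i"] sq[of "snd p $ i" "snd q $ i"] by (simp add: algebra_simps)
    then have "pi * ((fst (u *\<^sub>R p + v *\<^sub>R q) $ i)\<^sup>2 + (snd (u *\<^sub>R p + v *\<^sub>R q) $ i)\<^sup>2) / a i
      \<le> pi * (u * ((fst p $ i)\<^sup>2 + (snd p $ i)\<^sup>2) + v * ((fst q $ i)\<^sup>2 + (snd q $ i)\<^sup>2)) / a i"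
      using ai by (intro divide_right_mono mult_left_mono) auto
    then show "pi * ((fst (u *\<^sub>R p + v *\<^sub>R q) $ i)\<^sup>2 + (snd (u *\<^sub>R p + v *\<^sub>R q) $ i)\<^sup>2) / a i
      \<le> u * (pi * ((fst p $ i)\<^sup>2 + (snd p $ i)\<^sup>2) / a i) + v * (pi * ((fst q $ i)\<^sup>2 + (snd q $ i)\<^sup>2) / a i)"
      by (simp add: algebra_simps add_divide_distrib)
  qed
  also have "\<dots> = u * weighted_area S a p + v * weighted_area S a q"
    by (simp add: weighted_area_def sum.distrib sum_distrib_left)
  also have "\<dots> < c"
    using convex_bound_lt[of "weighted_area S a p" c "weighted_area S a q" u v] pq uv by auto
  finally show "u *\<^sub>R p + v *\<^sub>R q \<in> {p. weighted_area S a p < c}" by simp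
qed

lemma weighted_area_rotation:
  assumes "S \<subseteq> T"
  shows "weighted_area T a (rotation S a t p) = weighted_area S a p"
proof -
  have cs: "(C * x - D * y)\<^sup>2 + (D * x + C * y)\<^sup>2 = x\<^sup>2 + y\<^sup>2" if "D\<^sup>2 + C\<^sup>2 = 1" for C D x y :: real
  proof -
    have "(C * x - D * y)\<^sup>2 + (D * x + C * y)\<^sup>2 = (D\<^sup>2 + C\<^sup>2) * (x\<^sup>2 + y\<^sup>2)"
      by (simp add: power2_eq_square algebra_simps)
    then show ?thesis using that by simp
  qed
  show ?thesis
    unfolding weighted_area_def using assms
    by (intro sum.mono_neutral_cong_right) (auto simp: rotation_def cs)
qed

lemma rotation_inverse:
  "i \<in> S \<Longrightarrow> fst (rotation S a (- t) (rotation S a t p)) $ i = fst p $ i"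
  "i \<in> S \<Longrightarrow> snd (rotation S a (- t) (rotation S a t p)) $ i = snd p $ i"
proof -
  have "C * (C * x - D * y) + D * (D * x + C * y) = x" "C * (D * x + C * y) - D * (C * x - D * y) = y"
    if "D\<^sup>2 + C\<^sup>2 = 1" for C D x y :: real
    using that by algebra+
  then show "i \<in> S \<Longrightarrow> fst (rotation S a (- t) (rotation S a t p)) $ i = fst p $ i"
    "i \<in> S \<Longrightarrow> snd (rotation S a (- t) (rotation S a t p)) $ i = snd p $ i"
    by (simp_all add: rotation_def)
qed

lemma omega_rotation:
  "\<omega>\<^sub>0 (rotation S a t p) (rotation S a t q) = (\<Sum>i\<in>S. fst p $ i * snd q $ i - snd p $ i * fst q $ i)"
proof -
  have cs: "(C * x - D * y) * (D * x' + C * y') - (D * x + C * y) * (C * x' - D * y') = x * y' - y * x'"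
    if "D\<^sup>2 + C\<^sup>2 = 1" for C D x y x' y' :: real
    using that by algebra
  show ?thesis
    unfolding \<omega>\<^sub>0_def by (rule sum.mono_neutral_cong_right) (auto simp: rotation_def cs)
qed

lemma omega_rotation_field_rotation:
  "\<omega>\<^sub>0 (rotation S a t p) (rotation_field S a (rotation S a t q)) = \<omega>\<^sub>0 p (rotation_field S a q)"
proof -
  have cs: "(C * x - D * y) * (C * x' - D * y') + (D * x + C * y) * (D * x' + C * y') = x * x' + y * y'"
    if "D\<^sup>2 + C\<^sup>2 = 1" for C D x y x' y' :: real
    using that by algebra
  have *: "\<omega>\<^sub>0 p (rotation_field S a q)
      = (\<Sum>i\<in>S. 2 * pi / a i * (fst p $ i * fst q $ i + snd p $ i * snd q $ i))" for p q
    unfolding \<omega>\<^sub>0_def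
    by (rule sum.mono_neutral_cong_right) (auto simp: rotation_field_def algebra_simps add_divide_distrib)
  show ?thesis unfolding * by (intro sum.cong refl) (simp add: rotation_def cs)
qed

text \<open>
  When the time depends on the point, its variation contributes the velocity of the flow.
\<close>

lemma has_derivative_rotation:
  assumes "(\<tau> has_derivative \<tau>') (at p)"
  shows "((\<lambda>p. rotation S a (\<tau> p) p) has_derivative
    (\<lambda>v. rotation S a (\<tau> p) v + \<tau>' v *\<^sub>R rotation_field S a (rotation S a (\<tau> p) p))) (at p)"
proof -
  have c: "((\<lambda>p. cos (k * \<tau> p)) has_derivative (\<lambda>v. - sin (k * \<tau> p) * (k * \<tau>' v))) (at p)"
    and s: "((\<lambda>p. sin (k * \<tau> p)) has_derivative (\<lambda>v. cos (k * \<tau> p) * (k * \<tau>' v))) (at p)" for k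
    by (auto intro!: derivative_eq_intros assms)
  have x: "((\<lambda>p. fst p $ i) has_derivative (\<lambda>v. fst v $ i)) (at p)"
    and y: "((\<lambda>p. snd p $ i) has_derivative (\<lambda>v. snd v $ i)) (at p)" for i
    by (auto intro!: bounded_linear.has_derivative[OF bounded_linear_vec_nth] derivative_eq_intros)
  define k where "k = (\<lambda>i. 2 * pi / a i)"
  have "((\<lambda>p. rotation S a (\<tau> p) p) has_derivative (\<lambda>v.
     (\<chi> i. if i \<in> S then (cos (k i * \<tau> p) * fst v $ i + - sin (k i * \<tau> p) * (k i * \<tau>' v) * fst p $ i)
        - (sin (k i * \<tau> p) * snd v $ i + cos (k i * \<tau> p) * (k i * \<tau>' v) * snd p $ i) else 0,
      \<chi> i. if i \<in> S then (sin (k i * \<tau> p) * fst v $ i + cos (k i * \<tau> p) * (k i * \<tau>' v) * fst p $ i)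
        + (cos (k i * \<tau> p) * snd v $ i + - sin (k i * \<tau> p) * (k i * \<tau>' v) * snd p $ i) else 0))) (at p)"
    unfolding rotation_def k_def[symmetric] fun_cong[OF k_def, symmetric]
  proof (intro has_derivative_Pair has_derivative_vec_lambda)
    fix i
    show "((\<lambda>p. if i \<in> S then cos (k i * \<tau> p) * fst p $ i - sin (k i * \<tau> p) * snd p $ i else 0) has_derivative
      (\<lambda>v. if i \<in> S then (cos (k i * \<tau> p) * fst v $ i + - sin (k i * \<tau> p) * (k i * \<tau>' v) * fst p $ i)
        - (sin (k i * \<tau> p) * snd v $ i + cos (k i * \<tau> p) * (k i * \<tau>' v) * snd p $ i) else 0)) (at p)"
      by (cases "i \<in> S"; simp only: if_True if_False;
          intro has_derivative_diff has_derivative_mult c s x y has_derivative_const)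
    show "((\<lambda>p. if i \<in> S then sin (k i * \<tau> p) * fst p $ i + cos (k i * \<tau> p) * snd p $ i else 0) has_derivative
      (\<lambda>v. if i \<in> S then (sin (k i * \<tau> p) * fst v $ i + cos (k i * \<tau> p) * (k i * \<tau>' v) * fst p $ i)
        + (cos (k i * \<tau> p) * snd v $ i + - sin (k i * \<tau> p) * (k i * \<tau>' v) * snd p $ i) else 0)) (at p)"
      by (cases "i \<in> S"; simp only: if_True if_False;
          intro has_derivative_add has_derivative_mult c s x y has_derivative_const)
  qed
  then show ?thesis
    by (rule has_derivative_eq_rhs)
      (auto simp: fun_eq_iff rotation_def rotation_field_def prod_eq_iff vec_eq_iff k_def algebra_simps
        diff_divide_distrib add_divide_distrib)
qed

lemma Ck_on_rotation:
  assumes U: "open U" and \<tau>: "Ck_on k U \<tau>"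
  shows "Ck_on k U (\<lambda>p. rotation S a (\<tau> p) p)"
proof -
  have c: "Ck_on k U (\<lambda>p. cos (r * \<tau> p))" and s: "Ck_on k U (\<lambda>p. sin (r * \<tau> p))" for r
    using Ck_on_cos_sin[of k] Ck_on_mult[OF U Ck_on_const \<tau>, of r]
    by (auto intro: Ck_on_compose[OF U open_UNIV, where h = "\<lambda>p. r * \<tau> p"])
  have xy: "Ck_on k U (\<lambda>p. fst p $ i)" "Ck_on k U (\<lambda>p. snd p $ i)" for i
    by (intro Ck_on_linear[OF U bounded_linear_vec_nth] Ck_on_linear[OF U bounded_linear_fst]
        Ck_on_linear[OF U bounded_linear_snd] Ck_on_id U)+
  have *: "Ck_on k U (\<lambda>p. if i \<in> S then cos (r * \<tau> p) * fst p $ i - sin (r * \<tau> p) * snd p $ i else 0)"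
    "Ck_on k U (\<lambda>p. if i \<in> S then sin (r * \<tau> p) * fst p $ i + cos (r * \<tau> p) * snd p $ i else 0)" for i r
    by (cases "i \<in> S"; simp only: if_True if_False;
        intro Ck_on_diff Ck_on_add Ck_on_mult Ck_on_const c s xy U)+
  show ?thesis
    unfolding rotation_def by (intro Ck_on_Pair Ck_on_vec_lambda U *)
qed

section \<open>Splitting off a set of coordinate planes\<close>

definition coord_proj :: "('m \<Rightarrow> 'n) \<Rightarrow> (real^'n) \<times> (real^'n) \<Rightarrow> (real^'m) \<times> (real^'m)"
  where "coord_proj e p = (\<chi> i. fst p $ e i, \<chi> i. snd p $ e i)"

text \<open>
  For injective \<open>e\<close> this is the right inverse of \<^const>\<open>coord_proj\<close> onto the selected coordinate planes.
\<close>

definition coord_incl :: "('m \<Rightarrow> 'n) \<Rightarrow> (real^'m) \<times> (real^'m) \<Rightarrow> (real^'n) \<times> (real^'n)"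
  where "coord_incl e q =
    (\<chi> j. if j \<in> range e then fst q $ inv e j else 0, \<chi> j. if j \<in> range e then snd q $ inv e j else 0)"

lemma sum_UNIV_split_range:
  fixes e :: "'m::finite \<Rightarrow> 'n::finite" and h :: "'n \<Rightarrow> 'b::comm_monoid_add"
  assumes "inj e"
  shows "sum h UNIV = (\<Sum>i\<in>UNIV. h (e i)) + (\<Sum>j\<in>- range e. h j)"
proof -
  have "sum h UNIV = sum h (range e) + sum h (- range e)"
    by (metis Compl_disjoint Compl_partition finite sum.union_disjoint)
  then show ?thesis by (simp add: sum.reindex[OF assms] o_def)
qed

lemma bounded_linear_coord_proj:
  "bounded_linear (coord_proj e :: (real^'n::finite) \<times> (real^'n) \<Rightarrow> (real^'m::finite) \<times> (real^'m))"
  unfolding linear_conv_bounded_linear[symmetric]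
  by (intro linearI) (simp_all add: coord_proj_def prod_eq_iff vec_eq_iff)

lemma bounded_linear_coord_incl:
  "bounded_linear (coord_incl e :: (real^'m::finite) \<times> (real^'m) \<Rightarrow> (real^'n::finite) \<times> (real^'n))"
  unfolding linear_conv_bounded_linear[symmetric]
  by (intro linearI) (simp_all add: coord_incl_def prod_eq_iff vec_eq_iff)

lemma omega_coord_incl: "inj e \<Longrightarrow> \<omega>\<^sub>0 (coord_incl e p) (coord_incl e q) = \<omega>\<^sub>0 p q"
  by (simp add: \<omega>\<^sub>0_def sum_UNIV_split_range coord_incl_def)

lemma omega_coord_incl_rotation: "\<omega>\<^sub>0 (coord_incl e q) (rotation (- range e) a t p) = 0"
  unfolding \<omega>\<^sub>0_def by (rule sum.neutral) (auto simp: coord_incl_def rotation_def)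

lemma omega_coord_incl_rotation_field: "\<omega>\<^sub>0 (coord_incl e q) (rotation_field (- range e) a p) = 0"
  unfolding \<omega>\<^sub>0_def by (rule sum.neutral) (auto simp: coord_incl_def rotation_field_def)

lemma omega_split:
  "inj e \<Longrightarrow> \<omega>\<^sub>0 p q = \<omega>\<^sub>0 (coord_proj e p) (coord_proj e q)
     + \<omega>\<^sub>0 (rotation (- range e) a t p) (rotation (- range e) a t q)"
  unfolding omega_rotation by (simp add: \<omega>\<^sub>0_def sum_UNIV_split_range coord_proj_def)

lemma weighted_area_split:
  "inj e \<Longrightarrow> weighted_area UNIV a p
     = weighted_area UNIV (\<lambda>i. a (e i)) (coord_proj e p) + weighted_area (- range e) a p"
  by (simp add: weighted_area_def sum_UNIV_split_range coord_proj_def)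

lemma coord_proj_incl_plus_rotation:
  "inj e \<Longrightarrow> coord_proj e (coord_incl e q + rotation (- range e) a t p) = q"
  by (simp add: coord_proj_def coord_incl_def rotation_def prod_eq_iff vec_eq_iff)

lemma incl_plus_rotation_transverse:
  assumes "j \<in> - range e"
  shows "fst (coord_incl e q + rotation (- range e) a t p) $ j = fst (rotation (- range e) a t p) $ j"
    "snd (coord_incl e q + rotation (- range e) a t p) $ j = snd (rotation (- range e) a t p) $ j"
  using assms by (auto simp: coord_incl_def)

section \<open>The fibrewise embedding\<close>

text \<open>
  The map \<open>e\<close> selects the coordinate planes of the fibres, the others are the transverse ones. The
  open domain \<open>D\<close> is the interior of the ellipsoid enlarged by \<open>l\<close>; for \<open>l > 1\<close> it is a neighbourhood
  of the original closed ellipsoid. A point \<open>p\<close> of \<open>D\<close> with transverse weighted area \<open>K\<close> lies in a fibre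
  that is a copy of \<open>B\<close> scaled by \<open>s p = l - K > 0\<close>, and \<open>u p\<close> is its position after rescaling the
  fibre to \<open>B\<close>.
\<close>

locale ellipsoid_fibration =
  fixes e :: "'m::finite \<Rightarrow> 'n::finite" and a :: "'n \<Rightarrow> real" and l :: real
  assumes inj_e: "inj e" and a_pos: "\<And>j. a j > 0"
begin

definition B where "B = {q. weighted_area UNIV (\<lambda>i. a (e i)) q < 1}"
definition D where "D = {p. weighted_area UNIV a p < l}"
definition s where "s p = l - weighted_area (- range e) a p"
definition u where "u p = inverse (sqrt (s p)) *\<^sub>R coord_proj e p"

lemma open_B: "open B" and open_D: "open D"
  unfolding B_def D_def
  by (auto intro!: open_Collect_less continuous_on_weighted_area continuous_on_const)

lemma convex_B: "convex B"
  unfolding B_def by (rule convex_weighted_area_less) (rule a_pos)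

lemma zero_in_B: "0 \<in> B"
  by (simp add: B_def weighted_area_def)

lemma s_pos: "p \<in> D \<Longrightarrow> s p > 0"
  and u_in_B: "p \<in> D \<Longrightarrow> u p \<in> B"
proof -
  assume p: "p \<in> D"
  have less: "weighted_area UNIV (\<lambda>i. a (e i)) (coord_proj e p) < s p"
    using p weighted_area_split[OF inj_e, of a p] by (simp add: D_def s_def)
  moreover have "weighted_area UNIV (\<lambda>i. a (e i)) (coord_proj e p) \<ge> 0"
    by (rule weighted_area_nonneg) (rule a_pos)
  ultimately show s: "s p > 0" by linarith
  have "weighted_area UNIV (\<lambda>i. a (e i)) (u p)
      = weighted_area UNIV (\<lambda>i. a (e i)) (coord_proj e p) / s p"
    using s by (simp add: u_def weighted_area_scaleR power_inverse divide_inverse mult.commute)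
  then show "u p \<in> B" using less s by (simp add: B_def)
qed

lemma coord_proj_eq: "p \<in> D \<Longrightarrow> coord_proj e p = sqrt (s p) *\<^sub>R u p"
  using s_pos[of p] by (auto simp: u_def)

lemma Ck_on_s: "Ck_on k D s"
  unfolding s_def[abs_def] by (intro Ck_on_diff Ck_on_const Ck_on_weighted_area open_D)

lemma Ck_on_sqrt_s: "Ck_on k D (\<lambda>p. sqrt (s p))"
  by (rule Ck_on_compose[OF open_D _ _ Ck_on_sqrt Ck_on_s]) (auto simp: s_pos)

lemma Ck_on_u: "Ck_on k D u"
proof -
  have "Ck_on k D (\<lambda>p. inverse (sqrt (s p)))"
    by (rule Ck_on_compose[OF open_D _ _ Ck_on_inverse Ck_on_sqrt_s]) (auto simp: s_pos)
  then show ?thesis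
    unfolding u_def[abs_def]
    by (intro Ck_on_scaleR open_D Ck_on_linear[OF open_D bounded_linear_coord_proj] Ck_on_id)
qed

end

locale fibred_map = ellipsoid_fibration e a l
  for e :: "'m::finite \<Rightarrow> 'n::finite" and a :: "'n \<Rightarrow> real" and l :: real +
  fixes \<phi> :: "(real^'m) \<times> (real^'m) \<Rightarrow> (real^'m) \<times> (real^'m)"
    and g :: "(real^'m) \<times> (real^'m) \<Rightarrow> real"
begin

text \<open>
  The map \<open>\<phi>\<close>, rescaled to the fibre, acts on the fibre coordinates and the transverse coordinates are rotated for the time
  \<open>g (u p)\<close>.
\<close>

definition \<psi> where "\<psi> p = coord_incl e (sqrt (s p) *\<^sub>R \<phi> (u p)) + rotation (- range e) a (g (u p)) p"

lemma smooth_on_\<psi>: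
  assumes "smooth_on B \<phi>" "smooth_on B g"
  shows "smooth_on D \<psi>"
  unfolding smooth_on_def
proof
  fix k
  have uB: "u ` D \<subseteq> B" using u_in_B by auto
  have "Ck_on k D (\<lambda>p. \<phi> (u p))" "Ck_on k D (\<lambda>p. g (u p))"
    using assms unfolding smooth_on_def
    by (auto intro!: Ck_on_compose[OF open_D open_B uB _ Ck_on_u])
  then show "Ck_on k D \<psi>"
    unfolding \<psi>_def[abs_def]
    by (intro Ck_on_add Ck_on_linear[OF open_D bounded_linear_coord_incl] Ck_on_scaleR
        Ck_on_rotation Ck_on_sqrt_s open_D)
qed

text \<open>
  Here \<open>\<rho>\<close> is the derivative of \<open>\<lambda>p. sqrt (s p)\<close> and \<open>\<sigma>\<close> that of \<open>u\<close>. The latter is kept abstract: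
  differentiating \<open>coord_proj e p = sqrt (s p) *\<^sub>R u p\<close> gives the only relation about it that matters.
\<close>

lemma has_derivative_\<psi>:
  assumes p: "p \<in> D"
    and \<phi>: "(\<phi> has_derivative \<phi>') (at (u p))" and g: "(g has_derivative g') (at (u p))"
  obtains \<rho> \<sigma> where
    "\<And>v. 2 * sqrt (s p) * \<rho> v = - \<omega>\<^sub>0 v (rotation_field (- range e) a p)"
    "\<And>v. coord_proj e v = sqrt (s p) *\<^sub>R \<sigma> v + \<rho> v *\<^sub>R u p"
    "(\<psi> has_derivative (\<lambda>v. coord_incl e (sqrt (s p) *\<^sub>R \<phi>' (\<sigma> v) + \<rho> v *\<^sub>R \<phi> (u p))
       + (rotation (- range e) a (g (u p)) v
         + g' (\<sigma> v) *\<^sub>R rotation_field (- range e) a (rotation (- range e) a (g (u p)) p)))) (at p)"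
proof -
  define \<rho> where "\<rho> = (\<lambda>v. - \<omega>\<^sub>0 v (rotation_field (- range e) a p) * (inverse (sqrt (s p)) / 2))"
  define \<sigma> where "\<sigma> = frechet_derivative u (at p)"
  have sp: "s p > 0" using s_pos[OF p] .
  have "(s has_derivative (\<lambda>v. 0 - \<omega>\<^sub>0 v (rotation_field (- range e) a p))) (at p)"
    unfolding s_def[abs_def] by (intro has_derivative_diff has_derivative_const has_derivative_weighted_area)
  from has_derivative_real_sqrt[OF sp this]
  have dr: "((\<lambda>p. sqrt (s p)) has_derivative \<rho>) (at p)"
    by (simp add: \<rho>_def mult.commute)
  have du: "(u has_derivative \<sigma>) (at p)"
    unfolding \<sigma>_def using Ck_on_Suc_has_derivative[OF Ck_on_u p] .
  have "((\<lambda>p. sqrt (s p) *\<^sub>R u p) has_derivative (\<lambda>v. sqrt (s p) *\<^sub>R \<sigma> v + \<rho> v *\<^sub>R u p)) (at p)"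
    by (rule has_derivative_scaleR[OF dr du])
  then have "(coord_proj e has_derivative (\<lambda>v. sqrt (s p) *\<^sub>R \<sigma> v + \<rho> v *\<^sub>R u p)) (at p)"
    by (rule has_derivative_transform_within_open[OF _ open_D p]) (simp add: coord_proj_eq)
  then have "coord_proj e = (\<lambda>v. sqrt (s p) *\<^sub>R \<sigma> v + \<rho> v *\<^sub>R u p)"
    by (rule has_derivative_unique[OF bounded_linear_imp_has_derivative[OF bounded_linear_coord_proj]])
  then have 1: "coord_proj e v = sqrt (s p) *\<^sub>R \<sigma> v + \<rho> v *\<^sub>R u p" for v
    by (rule fun_cong)
  have 2: "2 * sqrt (s p) * \<rho> v = - \<omega>\<^sub>0 v (rotation_field (- range e) a p)" for v
    using sp by (simp add: \<rho>_def)
  have 3: "(\<psi> has_derivative (\<lambda>v. coord_incl e (sqrt (s p) *\<^sub>R \<phi>' (\<sigma> v) + \<rho> v *\<^sub>R \<phi> (u p))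
       + (rotation (- range e) a (g (u p)) v
         + g' (\<sigma> v) *\<^sub>R rotation_field (- range e) a (rotation (- range e) a (g (u p)) p)))) (at p)"
    unfolding \<psi>_def[abs_def]
    by (intro has_derivative_add bounded_linear.has_derivative[OF bounded_linear_coord_incl]
        has_derivative_scaleR dr has_derivative_rotation
        has_derivative_compose[OF du \<phi>] has_derivative_compose[OF du g])
  show thesis by (rule that[OF 2 1 3])
qed

text \<open>
  Let \<open>K\<close> be the transverse area, so that \<open>ds = - dK\<close>. Because \<open>\<phi>\<close> is composed with a scaling
  that varies with \<open>s\<close>, the fibre part changes the form by \<open>ds \<and> dg\<close>. Because the
  rotation is the flow of \<open>K\<close> for the variable time \<open>g\<close>, the transverse part changes it by
  \<open>dK \<and> dg\<close>. These two errors cancel.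
\<close>

lemma symplectic_\<psi>:
  assumes p: "p \<in> D"
    and \<phi>: "(\<phi> has_derivative \<phi>') (at (u p))" and sym: "\<And>x y. \<omega>\<^sub>0 (\<phi>' x) (\<phi>' y) = \<omega>\<^sub>0 x y"
    and g: "(g has_derivative (\<lambda>x. (\<omega>\<^sub>0 (\<phi> (u p)) (\<phi>' x) - \<omega>\<^sub>0 (u p) x) / 2)) (at (u p))"
  shows "\<omega>\<^sub>0 (frechet_derivative \<psi> (at p) v) (frechet_derivative \<psi> (at p) w) = \<omega>\<^sub>0 v w"
proof -
  interpret \<omega>n: bounded_bilinear "\<omega>\<^sub>0 :: (real^'n) \<times> (real^'n) \<Rightarrow> _ \<Rightarrow> real"
    by (rule bounded_bilinear_omega)
  interpret \<omega>m: bounded_bilinear "\<omega>\<^sub>0 :: (real^'m) \<times> (real^'m) \<Rightarrow> _ \<Rightarrow> real"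
    by (rule bounded_bilinear_omega)
  let ?R = "rotation (- range e) a (g (u p))" and ?A = "rotation_field (- range e) a"
  define r where "r = sqrt (s p)"
  define dg where "dg = (\<lambda>x. (\<omega>\<^sub>0 (\<phi> (u p)) (\<phi>' x) - \<omega>\<^sub>0 (u p) x) / 2)"
  obtain \<rho> \<sigma> where \<rho>: "\<And>v. 2 * r * \<rho> v = - \<omega>\<^sub>0 v (?A p)"
    and \<sigma>: "\<And>v. coord_proj e v = r *\<^sub>R \<sigma> v + \<rho> v *\<^sub>R u p"
    and der: "(\<psi> has_derivative (\<lambda>v. coord_incl e (r *\<^sub>R \<phi>' (\<sigma> v) + \<rho> v *\<^sub>R \<phi> (u p))
       + (?R v + dg (\<sigma> v) *\<^sub>R ?A (?R p)))) (at p)"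
    by (rule has_derivative_\<psi>[OF p \<phi> g[folded dg_def], folded r_def]) (rule that)
  define X where "X = (\<lambda>v. r *\<^sub>R \<phi>' (\<sigma> v) + \<rho> v *\<^sub>R \<phi> (u p))"
  define Y where "Y = (\<lambda>v. ?R v + dg (\<sigma> v) *\<^sub>R ?A (?R p))"
  have dg: "\<omega>\<^sub>0 (\<phi> (u p)) (\<phi>' x) = 2 * dg x + \<omega>\<^sub>0 (u p) x"
    "\<omega>\<^sub>0 (\<phi>' x) (\<phi> (u p)) = - (2 * dg x + \<omega>\<^sub>0 (u p) x)" for x
    by (simp_all add: dg_def omega_antisym[of "\<phi>' x"] field_simps)
  have zero': "\<omega>\<^sub>0 x x = 0" for x :: "(real^'m) \<times> (real^'m)"
    using omega_antisym[of x x] by simp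
  have zero'': "\<omega>\<^sub>0 x x = 0" for x :: "(real^'n) \<times> (real^'n)"
    using omega_antisym[of x x] by simp
  have P: "\<omega>\<^sub>0 (coord_proj e v) (coord_proj e w)
      = r * r * \<omega>\<^sub>0 (\<sigma> v) (\<sigma> w) + r * \<rho> v * \<omega>\<^sub>0 (u p) (\<sigma> w) - r * \<rho> w * \<omega>\<^sub>0 (u p) (\<sigma> v)"
    unfolding \<sigma>
    by (simp add: \<omega>m.add_left \<omega>m.add_right \<omega>m.scaleR_left \<omega>m.scaleR_right zero'
        omega_antisym[of "\<sigma> v" "u p"] algebra_simps)
  \<comment> \<open>The two extra terms are the value of \<open>ds \<and> dg\<close> on \<open>(v, w)\<close>, as \<open>2 r \<rho> = ds\<close>.\<close>
  have X: "\<omega>\<^sub>0 (X v) (X w) = \<omega>\<^sub>0 (coord_proj e v) (coord_proj e w)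
      + 2 * r * \<rho> v * dg (\<sigma> w) - 2 * r * \<rho> w * dg (\<sigma> v)"
    unfolding P X_def
    by (simp add: \<omega>m.add_left \<omega>m.add_right \<omega>m.scaleR_left \<omega>m.scaleR_right zero' sym dg algebra_simps)
  \<comment> \<open>The two extra terms are the value of \<open>dK \<and> dg\<close> on \<open>(v, w)\<close>.\<close>
  have Y: "\<omega>\<^sub>0 (Y v) (Y w) = \<omega>\<^sub>0 (?R v) (?R w)
      + dg (\<sigma> w) * \<omega>\<^sub>0 v (?A p) - dg (\<sigma> v) * \<omega>\<^sub>0 w (?A p)"
    unfolding Y_def
    by (simp add: \<omega>n.add_left \<omega>n.add_right \<omega>n.scaleR_left \<omega>n.scaleR_right zero''
        omega_rotation_field_rotation omega_antisym[of "?A (?R p)" "?R w"] algebra_simps)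
  have XY: "\<omega>\<^sub>0 (coord_incl e x) (Y w) = 0" "\<omega>\<^sub>0 (Y w) (coord_incl e x) = 0" for x w
    unfolding Y_def omega_antisym[of _ "coord_incl e x"]
    by (simp_all add: \<omega>n.add_right \<omega>n.scaleR_right omega_coord_incl_rotation omega_coord_incl_rotation_field)
  have "frechet_derivative \<psi> (at p) = (\<lambda>v. coord_incl e (X v) + Y v)"
    using frechet_derivative_at[OF der] unfolding X_def Y_def by simp
  then have "\<omega>\<^sub>0 (frechet_derivative \<psi> (at p) v) (frechet_derivative \<psi> (at p) w)
      = \<omega>\<^sub>0 (X v) (X w) + \<omega>\<^sub>0 (Y v) (Y w)"
    by (simp add: \<omega>n.add_left \<omega>n.add_right XY omega_coord_incl[OF inj_e])
  also have "\<dots> = \<omega>\<^sub>0 v w"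
    unfolding X Y \<rho> omega_split[OF inj_e, of v w a "g (u p)"] by (simp add: algebra_simps)
  finally show ?thesis .
qed

text \<open>
  Rotations preserve the transverse area, so the image determines \<open>s p\<close>; then its fibre part
  determines \<open>u p\<close>, hence the time of the rotation, which can be undone.
\<close>

lemma inj_on_\<psi>:
  assumes "inj_on \<phi> B"
  shows "inj_on \<psi> D"
proof (rule inj_onI)
  fix p p' assume D: "p \<in> D" "p' \<in> D" and eq: "\<psi> p = \<psi> p'"
  have trans: "fst (rotation (- range e) a (g (u p)) p) $ j = fst (rotation (- range e) a (g (u p')) p') $ j"
    "snd (rotation (- range e) a (g (u p)) p) $ j = snd (rotation (- range e) a (g (u p')) p') $ j"
    if "j \<in> - range e" for j
    using incl_plus_rotation_transverse[OF that] eq unfolding \<psi>_def by metis+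
  have rot: "rotation (- range e) a (g (u p)) p = rotation (- range e) a (g (u p')) p'"
  proof -
    have "fst (rotation (- range e) a (g (u p)) p) $ j = fst (rotation (- range e) a (g (u p')) p') $ j
      \<and> snd (rotation (- range e) a (g (u p)) p) $ j = snd (rotation (- range e) a (g (u p')) p') $ j" for j
      using trans[of j] by (cases "j \<in> range e") (auto simp: rotation_def)
    then show ?thesis by (simp add: prod_eq_iff vec_eq_iff)
  qed
  have s: "s p = s p'"
    using arg_cong[OF rot, of "weighted_area (- range e) a"]
    by (simp add: s_def weighted_area_rotation)
  have "sqrt (s p) *\<^sub>R \<phi> (u p) = sqrt (s p') *\<^sub>R \<phi> (u p')"
    using arg_cong[OF eq, of "coord_proj e"]
    by (simp add: \<psi>_def coord_proj_incl_plus_rotation[OF inj_e])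
  then have "\<phi> (u p) = \<phi> (u p')" using s_pos[OF D(2)] by (simp add: s)
  then have u: "u p = u p'" using inj_onD[OF assms _ u_in_B[OF D(1)] u_in_B[OF D(2)]] by blast
  then have proj: "coord_proj e p = coord_proj e p'" by (simp add: coord_proj_eq D s)
  have "fst p $ j = fst p' $ j \<and> snd p $ j = snd p' $ j" for j
  proof (cases "j \<in> range e")
    case True
    then show ?thesis using proj by (auto simp: coord_proj_def vec_eq_iff)
  next
    case False
    then show ?thesis
      using rotation_inverse[of j "- range e" a "g (u p)" p] rotation_inverse[of j "- range e" a "g (u p)" p']
        rot unfolding u by simp
  qed
  then show "p = p'" by (simp add: prod_eq_iff vec_eq_iff)
qed

text \<open>
  The fibre part of the image contributes at most \<open>s p * l\<close> and the rotation leaves the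
  transverse area \<open>l - s p\<close> unchanged.
\<close>

lemma weighted_area_\<psi>_le:
  assumes "p \<in> D" and "l > 1" and "weighted_area UNIV a' (\<phi> (u p)) \<le> l"
  shows "weighted_area UNIV (\<lambda>j. if j \<in> range e then a' (inv e j) else a j) (\<psi> p) \<le> l * l"
proof -
  let ?b = "\<lambda>j. if j \<in> range e then a' (inv e j) else a j"
  have "weighted_area (- range e) ?b (\<psi> p)
      = weighted_area (- range e) a (rotation (- range e) a (g (u p)) p)"
    unfolding weighted_area_def \<psi>_def
    by (intro sum.cong refl) (simp only: incl_plus_rotation_transverse, simp)
  also have "\<dots> = l - s p"
    by (simp add: weighted_area_rotation s_def)
  finally have transverse: "weighted_area (- range e) ?b (\<psi> p) = l - s p" .
  have "weighted_area UNIV ?b (\<psi> p) = weighted_area UNIV a' (sqrt (s p) *\<^sub>R \<phi> (u p)) + (l - s p)"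
    unfolding weighted_area_split[OF inj_e, of ?b] transverse
    by (simp add: \<psi>_def coord_proj_incl_plus_rotation[OF inj_e] inv_f_f[OF inj_e])
  also have "\<dots> = s p * weighted_area UNIV a' (\<phi> (u p)) + (l - s p)"
    using s_pos[OF assms(1)] by (simp add: weighted_area_scaleR)
  also have "\<dots> \<le> s p * l + (l - s p)"
    using s_pos[OF assms(1)] assms(3) by simp
  also have "\<dots> = l * l - (l - 1) * (l - s p)" by (simp add: algebra_simps)
  also have "\<dots> \<le> l * l"
    using assms(2) weighted_area_nonneg[of "- range e" a p] a_pos by (simp add: s_def)
  finally show ?thesis .
qed

end

section \<open>Extending embeddings of ellipsoids\<close>

lemma compact_ellipsoid:
  fixes a :: "'n::finite \<Rightarrow> real"
  assumes "\<And>i. a i > 0"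
  shows "compact (ellipsoid a)"
proof -
  have "closed (ellipsoid a)"
    unfolding ellipsoid_eq_weighted_area
    by (intro closed_Collect_le continuous_on_weighted_area continuous_on_const)
  moreover have "bounded (ellipsoid a)"
  proof -
    have le: "(fst p $ i)\<^sup>2 + (snd p $ i)\<^sup>2 \<le> a i / pi" if "p \<in> ellipsoid a" for p i
    proof -
      have "pi * ((fst p $ i)\<^sup>2 + (snd p $ i)\<^sup>2) / a i \<le> weighted_area UNIV a p"
        unfolding weighted_area_def
        by (rule member_le_sum) (auto simp: less_imp_le[OF assms])
      also have "\<dots> \<le> 1" using that by (simp add: ellipsoid_eq_weighted_area)
      finally show ?thesis using assms[of i] by (simp add: field_simps)
    qed
    define M where "M = (\<Sum>i\<in>UNIV. sqrt (a i / pi))"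
    have bd: "norm (fst p) \<le> M" "norm (snd p) \<le> M" if "p \<in> ellipsoid a" for p
    proof -
      have c: "\<bar>fst p $ i\<bar> \<le> sqrt (a i / pi)" "\<bar>snd p $ i\<bar> \<le> sqrt (a i / pi)" for i
      proof -
        have "\<bar>fst p $ i\<bar>\<^sup>2 \<le> a i / pi" "\<bar>snd p $ i\<bar>\<^sup>2 \<le> a i / pi"
          using le[OF that, of i] zero_le_power2[of "fst p $ i"] zero_le_power2[of "snd p $ i"]
          unfolding power2_abs by linarith+
        then show "\<bar>fst p $ i\<bar> \<le> sqrt (a i / pi)" "\<bar>snd p $ i\<bar> \<le> sqrt (a i / pi)"
          by (auto intro: real_le_rsqrt)
      qed
      show "norm (fst p) \<le> M" "norm (snd p) \<le> M"
        unfolding M_def using c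
        by (auto intro!: order_trans[OF norm_le_l1_cart] sum_mono)
    qed
    have "norm p \<le> M + M" if "p \<in> ellipsoid a" for p
      using norm_Pair_le[of "fst p" "snd p"] bd[OF that] by simp
    then show ?thesis unfolding bounded_iff by blast
  qed
  ultimately show ?thesis by (simp add: compact_eq_bounded_closed)
qed

text \<open>
  The permitted factor \<open>c\<close> is spent in two equal parts \<open>l = sqrt c\<close>: one bounds the image of the given
  embedding, the other enlarges the domain so that \<open>u\<close> stays in the open set \<open>B\<close>. There \<open>\<phi>\<close> is
  symplectic on a whole neighbourhood of each point, as the primitive \<open>g\<close> requires, whereas outside
  the closed ellipsoid nothing is known of \<open>\<phi>\<close> beyond smoothness nearby.
\<close>

lemma ellipsoid_embeds_extend:
  fixes e :: "'m::finite \<Rightarrow> 'n::finite" and a :: "'n \<Rightarrow> real" and a' :: "'m \<Rightarrow> real"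
  assumes "inj e" and a: "\<And>j. a j > 0" and emb: "(\<lambda>i. a (e i)) \<hookrightarrow>\<^sub>E a'"
  shows "a \<hookrightarrow>\<^sub>E (\<lambda>j. if j \<in> range e then a' (inv e j) else a j)"
  unfolding ellipsoid_embeds_def
proof (intro allI impI)
  fix c :: real assume "c > 1"
  define l where "l = sqrt c"
  have l: "l > 1" "l * l = c" using \<open>c > 1\<close> by (auto simp: l_def)
  obtain \<phi> where \<phi>: "symplectic_embedding_on (ellipsoid (\<lambda>i. a (e i))) \<phi>"
    and im: "\<phi> ` ellipsoid (\<lambda>i. a (e i)) \<subseteq> ellipsoid (\<lambda>i. l * a' i)"
    using emb l(1) unfolding ellipsoid_embeds_def by blast
  interpret ellipsoid_fibration e a l
    by unfold_locales (rule assms)+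
  have BE: "B \<subseteq> ellipsoid (\<lambda>i. a (e i))"
    by (auto simp: B_def ellipsoid_eq_weighted_area)
  obtain U where "ellipsoid (\<lambda>i. a (e i)) \<subseteq> U" "smooth_on U \<phi>"
    using \<phi> unfolding symplectic_embedding_on_def smooth_embedding_on_def by blast
  then have sm: "smooth_on B \<phi>"
    using BE unfolding smooth_on_def by (blast intro: Ck_on_subset)
  have sym: "\<omega>\<^sub>0 (frechet_derivative \<phi> (at x) v) (frechet_derivative \<phi> (at x) w) = \<omega>\<^sub>0 v w"
    if "x \<in> B" for x v w
    using \<phi> BE that unfolding symplectic_embedding_on_def by blast
  have inj: "inj_on \<phi> B"
  proof -
    obtain h where "homeomorphism (ellipsoid (\<lambda>i. a (e i))) (\<phi> ` ellipsoid (\<lambda>i. a (e i))) \<phi> h"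
      using \<phi> unfolding symplectic_embedding_on_def smooth_embedding_on_def by blast
    then show ?thesis using BE unfolding homeomorphism_def by (metis inj_onI subsetD)
  qed
  obtain g where smg: "smooth_on B g" and g: "\<And>x. x \<in> B \<Longrightarrow>
      (g has_derivative (\<lambda>v. (\<omega>\<^sub>0 (\<phi> x) (frechet_derivative \<phi> (at x) v) - \<omega>\<^sub>0 x v) / 2)) (at x)"
    using liouville_primitive[OF open_B convex_B zero_in_B sm sym] by blast
  interpret fibred_map e a l \<phi> g
    by unfold_locales
  have ED: "ellipsoid a \<subseteq> D"
    using l by (auto simp: D_def ellipsoid_eq_weighted_area)
  have smooth: "smooth_on D \<psi>" by (rule smooth_on_\<psi>[OF sm smg])
  have C: "Ck_on k D \<psi>" for k using smooth by (simp add: smooth_on_def)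
  have \<phi>': "(\<phi> has_derivative frechet_derivative \<phi> (at x)) (at x)" if "x \<in> B" for x
    using sm that unfolding smooth_on_def by (blast intro: Ck_on_Suc_has_derivative)
  have symp: "\<omega>\<^sub>0 (frechet_derivative \<psi> (at p) v) (frechet_derivative \<psi> (at p) w) = \<omega>\<^sub>0 v w"
    if "p \<in> D" for p v w
    using symplectic_\<psi>[OF that \<phi>' sym g] u_in_B[OF that] by blast
  have injD: "inj (frechet_derivative \<psi> (at p))" if "p \<in> D" for p
    using has_derivative_linear[OF Ck_on_Suc_has_derivative[OF C that]] symp[OF that]
    by (rule inj_of_symplectic)
  have "continuous_on (ellipsoid a) \<psi>"
    using Ck_on_subset[OF C[of 0] ED] by simp
  then have "\<exists>h. homeomorphism (ellipsoid a) (\<psi> ` ellipsoid a) \<psi> h"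
    by (rule homeomorphism_compact[OF compact_ellipsoid[OF a] _ refl inj_on_subset[OF inj_on_\<psi>[OF inj] ED]])
  then have "symplectic_embedding_on (ellipsoid a) \<psi>"
    unfolding symplectic_embedding_on_def smooth_embedding_on_def
    using open_D ED smooth injD symp by blast
  moreover have "\<psi> p \<in> ellipsoid (\<lambda>j. c * (if j \<in> range e then a' (inv e j) else a j))"
    if p: "p \<in> ellipsoid a" for p
  proof -
    have pD: "p \<in> D" using p ED by blast
    have "\<phi> (u p) \<in> ellipsoid (\<lambda>i. l * a' i)"
      using u_in_B[OF pD] BE im by blast
    then have "weighted_area UNIV a' (\<phi> (u p)) \<le> l"
      using l by (simp add: ellipsoid_eq_weighted_area weighted_area_scale_weights field_simps)
    from weighted_area_\<psi>_le[OF pD l(1) this] show ?thesis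
      using \<open>c > 1\<close> by (simp add: ellipsoid_eq_weighted_area weighted_area_scale_weights l(2))
  qed
  ultimately show "\<exists>f. symplectic_embedding_on (ellipsoid a) f \<and>
      f ` ellipsoid a \<subseteq> ellipsoid (\<lambda>j. c * (if j \<in> range e then a' (inv e j) else a j))"
    by blast
qed

theorem proposition1p1:
  fixes m n :: nat
    and a a' :: "nat \<Rightarrow> real"
    and \<mu> :: "'m::finite \<Rightarrow> nat"
    and \<nu> :: "'n::finite \<Rightarrow> nat"
  assumes "1 \<le> m" and "m \<le> n"
    and "bij_betw \<mu> UNIV {1..m}"
    and "bij_betw \<nu> UNIV {1..n}"
    and "\<And>i. i \<in> {1..m} \<Longrightarrow> a i > 0"
    and "\<And>i. i \<in> {1..m} \<Longrightarrow> a' i > 0"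
    and "(\<lambda>i. a (\<mu> i)) \<hookrightarrow>\<^sub>E (\<lambda>i. a' (\<mu> i))"
    and "\<And>i. i \<in> {m+1..n} \<Longrightarrow> a i > 0"
  shows "(\<lambda>j. a (\<nu> j)) \<hookrightarrow>\<^sub>E (\<lambda>j. if \<nu> j \<le> m then a' (\<nu> j) else a (\<nu> j))"
proof -
  define e where "e = (\<lambda>i. inv \<nu> (\<mu> i))"
  have inj\<nu>: "inj \<nu>" and ran\<nu>: "range \<nu> = {1..n}"
    using assms(4) by (auto simp: bij_betw_def)
  have inj\<mu>: "inj \<mu>" and ran\<mu>: "range \<mu> = {1..m}"
    using assms(3) by (auto simp: bij_betw_def)
  have \<mu>: "\<mu> i \<in> {1..m}" for i using ran\<mu> by blast
  have \<nu>: "\<nu> j \<in> {1..n}" for j using ran\<nu> by blast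
  have \<nu>e: "\<nu> (e i) = \<mu> i" for i
    unfolding e_def using \<mu>[of i] ran\<nu> assms(2) by (intro f_inv_into_f) auto
  have inje: "inj e" using inj\<mu> \<nu>e by (metis injI injD)
  have rane: "j \<in> range e \<longleftrightarrow> \<nu> j \<le> m" for j
  proof
    assume "j \<in> range e" then show "\<nu> j \<le> m" using \<nu>e \<mu> by auto
  next
    assume "\<nu> j \<le> m"
    then have "\<nu> j \<in> range \<mu>" using ran\<mu> \<nu>[of j] by auto
    then obtain i where "\<nu> j = \<nu> (e i)" using \<nu>e by auto
    then show "j \<in> range e" using inj\<nu> by (auto dest: injD)
  qed
  have pos: "a (\<nu> j) > 0" for j
    using assms(5)[of "\<nu> j"] assms(8)[of "\<nu> j"] \<nu>[of j] by (cases "\<nu> j \<le> m") auto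
  have "(\<lambda>j. a (\<nu> j)) \<hookrightarrow>\<^sub>E (\<lambda>j. if j \<in> range e then a' (\<mu> (inv e j)) else a (\<nu> j))"
    by (rule ellipsoid_embeds_extend[OF inje pos]) (use assms(7) \<nu>e in simp)
  moreover have "(\<lambda>j. if j \<in> range e then a' (\<mu> (inv e j)) else a (\<nu> j))
      = (\<lambda>j. if \<nu> j \<le> m then a' (\<nu> j) else a (\<nu> j))"
    using f_inv_into_f[of _ e UNIV] by (auto simp: fun_eq_iff rane \<nu>e[symmetric])
  ultimately show ?thesis by simp
qed

end
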